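(* Let $\mathcal{S}$ be a thick generalized quadrangle of order $(s,s^2)$ such that (i) $\mathcal{S}$ has a line $L$ all of whose points are translation points; (ii) $\mathcal{S}$ has a subquadrangle $\mathcal{S}'$ of order $s$ containing $L$; (iii) every subtended ovoid in $\mathcal{S}'$ is doubly subtended. Then the natural projection $\pi:\mathcal{A}\to\mathcal{E}$ has the higher decomposition property: every cover $\gamma:\mathcal{A}\to\mathcal{E}$ factorizes as $\gamma=\pi\circ\widetilde{\alpha}$ for some automorphism $\widetilde{\alpha}$ of $\mathcal{S}$ stabilizing $\mathcal{S}'$ (acting on $\mathcal{A}$ by restriction).
   Context: A point of a GQ of order $(s,t)$ is a translation point if every line through it is an axis of symmetry (the group of automorphisms fixing every line concurrent with the line has order $s$). For a point $x$ of $\mathcal{S}$ not in $\mathcal{S}'$, $\mathcal{O}_x=x^\perp\cap\mathcal{S}'$ (points of $\mathcal{S}'$ collinear with $x$) is an ovoid of $\mathcal{S}'$ subtended by $x$; doubly subtended means exactly two points of $\mathcal{S}\setminus\mathcal{S}'$ subtend it. $\mathcal{A}$ is the geometry of points and lines of $\mathcal{S}$ not in $\mathcal{S}'$; $\mathcal{E}$ has as points the subtended ovoids and as lines the rosettes $R_N=\{\mathcal{O}_y : y \text{ on } N,\ y\notin\mathcal{S}'\}$ ($N$ a line of $\mathcal{S}$ not in $\mathcal{S}'$), incidence being containment. The projection $\pi$ maps $x\mapsto\mathcal{O}_x$ and $N\mapsto R_N$. A cover is an incidence-preserving map (points to points, lines to lines) which induces bijections between lines through a point and lines through its image, and between points on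 a line and points on its image. *)

theory Defs
  imports Main "HOL-Combinatorics.Permutations"
begin

record ('p, 'l) geometry =
  points :: "'p set"
  lines :: "'l set"
  inc :: "('p \<times> 'l) set"

definition points_on :: "('p, 'l) geometry \<Rightarrow> 'l \<Rightarrow> 'p set" where
  "points_on S N = {x \<in> points S. (x, N) \<in> inc S}"

definition lines_through :: "('p, 'l) geometry \<Rightarrow> 'p \<Rightarrow> 'l set" where
  "lines_through S x = {N \<in> lines S. (x, N) \<in> inc S}"

definition collinear :: "('p, 'l) geometry \<Rightarrow> 'p \<Rightarrow> 'p \<Rightarrow> bool" where
  "collinear S x y \<longleftrightarrow> (\<exists>N\<in>lines S. (x, N) \<in> inc S \<and> (y, N) \<in> inc S)"

definition concurrent :: "('p, 'l) geometry \<Rightarrow> 'l \<Rightarrow> 'l \<Rightarrow> bool" where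
  "concurrent S M N \<longleftrightarrow> (\<exists>x\<in>points S. (x, M) \<in> inc S \<and> (x, N) \<in> inc S)"

text \<open>That two distinct lines share at most one point is the same formula as that two distinct points
  lie on at most one common line, so it is listed once.\<close>

definition GQ :: "('p, 'l) geometry \<Rightarrow> nat \<Rightarrow> nat \<Rightarrow> bool" where
  "GQ S s t \<longleftrightarrow>
     points S \<noteq> {} \<and> lines S \<noteq> {} \<and> inc S \<subseteq> points S \<times> lines S \<and>
     s \<ge> 1 \<and> t \<ge> 1 \<and>
     (\<forall>x\<in>points S. card (lines_through S x) = t + 1) \<and>
     (\<forall>x\<in>points S. \<forall>y\<in>points S. x \<noteq> y \<longrightarrow>
        (\<forall>M\<in>lines S. \<forall>N\<in>lines S.
           (x, M) \<in> inc S \<and> (y, M) \<in> inc S \<and> (x, N) \<in> inc S \<and> (y, N) \<in> inc S \<longrightarrow> M = N)) \<and>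
     (\<forall>N\<in>lines S. card (points_on S N) = s + 1) \<and>
     (\<forall>x\<in>points S. \<forall>N\<in>lines S. (x, N) \<notin> inc S \<longrightarrow>
        (\<exists>!(y, M). y \<in> points S \<and> M \<in> lines S \<and>
           (x, M) \<in> inc S \<and> (y, M) \<in> inc S \<and> (y, N) \<in> inc S))"

definition thick_GQ :: "('p, 'l) geometry \<Rightarrow> nat \<Rightarrow> nat \<Rightarrow> bool" where
  "thick_GQ S s t \<longleftrightarrow> GQ S s t \<and> s > 1 \<and> t > 1"

definition subquadrangle :: "('p, 'l) geometry \<Rightarrow> ('p, 'l) geometry \<Rightarrow> nat \<Rightarrow> nat \<Rightarrow> bool" where
  "subquadrangle S' S s t \<longleftrightarrow>
     GQ S' s t \<and> points S' \<subseteq> points S \<and> lines S' \<subseteq> lines S \<and>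
     inc S' = inc S \<inter> (points S' \<times> lines S')"

text \<open>Automorphisms are pairs of permutations that are the identity off the carriers, so that
  distinct pairs are distinct automorphisms and sets of automorphisms can be counted.\<close>

definition automorphism :: "('p, 'l) geometry \<Rightarrow> ('p \<Rightarrow> 'p) \<Rightarrow> ('l \<Rightarrow> 'l) \<Rightarrow> bool" where
  "automorphism S f g \<longleftrightarrow>
     f permutes points S \<and> g permutes lines S \<and>
     (\<forall>x\<in>points S. \<forall>N\<in>lines S. (f x, g N) \<in> inc S \<longleftrightarrow> (x, N) \<in> inc S)"

definition symmetries_about :: "('p, 'l) geometry \<Rightarrow> 'l \<Rightarrow> (('p \<Rightarrow> 'p) \<times> ('l \<Rightarrow> 'l)) set" where
  "symmetries_about S N =
     {(f, g). automorphism S f g \<and> (\<forall>M\<in>lines S. concurrent S M N \<longrightarrow> g M = M)}"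

text \<open>In the next two definitions \<open>s\<close> is the first parameter of the order \<open>(s, t)\<close> of \<open>S\<close>.\<close>

definition axis_of_symmetry :: "('p, 'l) geometry \<Rightarrow> nat \<Rightarrow> 'l \<Rightarrow> bool" where
  "axis_of_symmetry S s N \<longleftrightarrow> N \<in> lines S \<and> card (symmetries_about S N) = s"

definition translation_point :: "('p, 'l) geometry \<Rightarrow> nat \<Rightarrow> 'p \<Rightarrow> bool" where
  "translation_point S s x \<longleftrightarrow>
     x \<in> points S \<and> (\<forall>N\<in>lines_through S x. axis_of_symmetry S s N)"

definition subtended_by :: "('p, 'l) geometry \<Rightarrow> ('p, 'l) geometry \<Rightarrow> 'p \<Rightarrow> 'p set" where
  "subtended_by S S' x = {z \<in> points S'. collinear S x z}"

definition rosette :: "('p, 'l) geometry \<Rightarrow> ('p, 'l) geometry \<Rightarrow> 'l \<Rightarrow> 'p set set" where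
  "rosette S S' N = {subtended_by S S' y | y. y \<in> points_on S N \<and> y \<notin> points S'}"

definition subtended_ovoids :: "('p, 'l) geometry \<Rightarrow> ('p, 'l) geometry \<Rightarrow> 'p set set" where
  "subtended_ovoids S S' = subtended_by S S' ` (points S - points S')"

definition doubly_subtended :: "('p, 'l) geometry \<Rightarrow> ('p, 'l) geometry \<Rightarrow> 'p set \<Rightarrow> bool" where
  "doubly_subtended S S' O' \<longleftrightarrow>
     card {x \<in> points S - points S'. subtended_by S S' x = O'} = 2"

definition geom_A :: "('p, 'l) geometry \<Rightarrow> ('p, 'l) geometry \<Rightarrow> ('p, 'l) geometry" where
  "geom_A S S' =
     \<lparr>points = points S - points S', lines = lines S - lines S',
      inc = inc S \<inter> ((points S - points S') \<times> (lines S - lines S'))\<rparr>"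

definition geom_E :: "('p, 'l) geometry \<Rightarrow> ('p, 'l) geometry \<Rightarrow> ('p set, 'p set set) geometry" where
  "geom_E S S' =
     \<lparr>points = subtended_ovoids S S', lines = rosette S S' ` (lines S - lines S'),
      inc = {(O', R). O' \<in> subtended_ovoids S S' \<and> R \<in> rosette S S' ` (lines S - lines S') \<and> O' \<in> R}\<rparr>"

definition cover ::
  "('p, 'l) geometry \<Rightarrow> ('q, 'm) geometry \<Rightarrow> ('p \<Rightarrow> 'q) \<Rightarrow> ('l \<Rightarrow> 'm) \<Rightarrow> bool" where
  "cover A E f g \<longleftrightarrow>
     f ` points A \<subseteq> points E \<and> g ` lines A \<subseteq> lines E \<and>
     (\<forall>x\<in>points A. \<forall>N\<in>lines A. (x, N) \<in> inc A \<longrightarrow> (f x, g N) \<in> inc E) \<and>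
     (\<forall>x\<in>points A. bij_betw g (lines_through A x) (lines_through E (f x))) \<and>
     (\<forall>N\<in>lines A. bij_betw f (points_on A N) (points_on E (g N)))"

definition stabilizes ::
  "('p \<Rightarrow> 'p) \<Rightarrow> ('l \<Rightarrow> 'l) \<Rightarrow> ('p, 'l) geometry \<Rightarrow> bool" where
  "stabilizes f g S' \<longleftrightarrow> f ` points S' = points S' \<and> g ` lines S' = lines S'"

text \<open>The natural projection is the pair \<open>(subtended_by S S', rosette S S')\<close>. Maps out of
  \<open>geom_A S S'\<close> are compared only on its points and lines.\<close>

definition higher_decomposition_property ::
  "('p, 'l) geometry \<Rightarrow> ('p, 'l) geometry \<Rightarrow> ('p \<Rightarrow> 'p set) \<Rightarrow> ('l \<Rightarrow> 'p set set) \<Rightarrow> bool" where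
  "higher_decomposition_property S S' \<pi>\<^sub>p \<pi>\<^sub>l \<longleftrightarrow>
     (\<forall>\<gamma>\<^sub>p \<gamma>\<^sub>l. cover (geom_A S S') (geom_E S S') \<gamma>\<^sub>p \<gamma>\<^sub>l \<longrightarrow>
        (\<exists>\<alpha>\<^sub>p \<alpha>\<^sub>l. automorphism S \<alpha>\<^sub>p \<alpha>\<^sub>l \<and> stabilizes \<alpha>\<^sub>p \<alpha>\<^sub>l S' \<and>
           (\<forall>x\<in>points (geom_A S S'). \<gamma>\<^sub>p x = \<pi>\<^sub>p (\<alpha>\<^sub>p x)) \<and>
           (\<forall>N\<in>lines (geom_A S S'). \<gamma>\<^sub>l N = \<pi>\<^sub>l (\<alpha>\<^sub>l N))))"

end

theory Submission
  imports Defs Complex_Main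
begin

text \<open>A line outside \<open>S'\<close> has exactly one point in \<open>S'\<close>, and mapping each point to the other point
  that subtends the same ovoid (its twin) preserves collinearity, because a triad of a quadrangle of
  order \<open>(s, s\<^sup>2)\<close> has \<open>s + 1\<close> centers. A cover has the same fibers \<open>{x, twin x}\<close> as the projection,
  since \<open>\<E>\<close> is a partial linear space. It remains to lift the cover through the projection, i.e. to
  show that closed paths of \<open>\<A>\<close> have images that lift to closed paths. Three points of \<open>\<E>\<close> that are
  pairwise, but not all three, on a common line lift to a path from a point to its twin both under the cover and under the
  projection, so triangles cause no obstruction. Quadrangles decompose into triangles: the common
  neighbours in \<open>\<A>\<close> of two non-collinear points, two of them being joined when one is collinear
  with the twin of the other, form a connected graph because its valency \<open>s + 1\<close> exceeds the second
  largest eigenvalue \<open>s - 1\<close> of the collinearity graph of \<open>S\<close>. Longer paths reduce to these. The lift is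
  an automorphism of \<open>\<A>\<close> and extends to \<open>S\<close>, since the points of \<open>S'\<close> are recovered from \<open>\<A>\<close> as
  parallel classes of lines.\<close>

section \<open>Generalized quadrangles\<close>

text \<open>The projection is two-to-one, so the obstruction along a closed path is a single bit:
  the lifted path returns to its start or ends at the twin. Collinearity alone reveals this bit,
  since a point outside \<open>S'\<close> is collinear with at most one of two twins. The lift is
  prescribed from a base point \<open>x\<^sub>0\<close>, and paths of length two suffice: a point
  \<open>y\<close> for which neither \<open>y\<close> nor its twin is collinear with
  \<open>x\<^sub>0\<close> still has a common neighbour with \<open>x\<^sub>0\<close> outside
  \<open>S'\<close>. What remains is compatibility with single edges. The obstacle is an edge
  between two such far points. The point of its line that is collinear with \<open>x\<^sub>0\<close>
  settles the matter unless it lies in \<open>S'\<close>; then the edge is completed to a triangle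
  of \<E> whose two other sides are harmless. Counting finds such a triangle when s > 2, and for s =
  2 there are no far points.\<close>

locale generalized_quadrangle =
  fixes S :: "('p, 'l) geometry" and s t :: nat
  assumes GQ: "GQ S s t"
begin

abbreviation on :: "'p \<Rightarrow> 'l \<Rightarrow> bool" where "on x N \<equiv> (x, N) \<in> inc S"
abbreviation col :: "'p \<Rightarrow> 'p \<Rightarrow> bool" (infix "\<sim>" 50) where "x \<sim> y \<equiv> collinear S x y"

lemma on_point: "on x N \<Longrightarrow> x \<in> points S" and on_line: "on x N \<Longrightarrow> N \<in> lines S"
  using GQ unfolding GQ_def by auto

lemma s_pos: "s \<ge> 1" and t_pos: "t \<ge> 1"
  using GQ unfolding GQ_def by auto

lemma card_lines_through: "x \<in> points S \<Longrightarrow> card (lines_through S x) = t + 1"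
  and card_points_on: "N \<in> lines S \<Longrightarrow> card (points_on S N) = s + 1"
  using GQ unfolding GQ_def by auto

lemma mem_points_on [simp]: "x \<in> points_on S N \<longleftrightarrow> on x N"
  using on_point by (auto simp: points_on_def)

lemma mem_lines_through [simp]: "N \<in> lines_through S x \<longleftrightarrow> on x N"
  using on_line by (auto simp: lines_through_def)

lemma finite_points_on: "finite (points_on S N)"
proof (cases "N \<in> lines S")
  case True
  then show ?thesis using card_points_on[OF True] by (metis add_is_0 card.infinite one_neq_zero)
next
  case False
  then have "points_on S N = {}" using on_line by auto
  then show ?thesis by simp
qed

lemma finite_lines_through: "finite (lines_through S x)"
proof (cases "x \<in> points S")
  case True
  then show ?thesis using card_lines_through[OF True] by (metis add_is_0 card.infinite one_neq_zero)
next
  case False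
  then have "lines_through S x = {}" using on_point by auto
  then show ?thesis by simp
qed

lemma line_eq:
  assumes "on x M" "on y M" "on x N" "on y N" "x \<noteq> y"
  shows "M = N"
proof -
  have "\<forall>x\<in>points S. \<forall>y\<in>points S. x \<noteq> y \<longrightarrow>
      (\<forall>M\<in>lines S. \<forall>N\<in>lines S. on x M \<and> on y M \<and> on x N \<and> on y N \<longrightarrow> M = N)"
    using GQ unfolding GQ_def by (elim conjE)
  from this[rule_format, of x y M N] show ?thesis using assms on_point on_line by blast
qed

lemma proj_axiom:
  assumes "x \<in> points S" "N \<in> lines S" "\<not> on x N"
  shows "\<exists>!(y, M). y \<in> points S \<and> M \<in> lines S \<and> on x M \<and> on y M \<and> on y N"
proof -
  have "\<forall>x\<in>points S. \<forall>N\<in>lines S. \<not> on x N \<longrightarrow>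
      (\<exists>!(y, M). y \<in> points S \<and> M \<in> lines S \<and> on x M \<and> on y M \<and> on y N)"
    using GQ unfolding GQ_def by (elim conjE)
  then show ?thesis using assms by (elim ballE impE) auto
qed

lemma colI: "on x N \<Longrightarrow> on y N \<Longrightarrow> x \<sim> y"
  using on_line by (auto simp: collinear_def)

lemma colE: assumes "x \<sim> y" obtains N where "on x N" "on y N"
  using assms by (auto simp: collinear_def)

lemma col_sym: "x \<sim> y \<Longrightarrow> y \<sim> x"
  by (auto simp: collinear_def)

lemma col_point: "x \<sim> y \<Longrightarrow> x \<in> points S"
  using on_point by (auto simp: collinear_def)

lemma ex_line: assumes "x \<in> points S" obtains N where "on x N"
proof -
  have "lines_through S x \<noteq> {}" using card_lines_through[OF assms] by force
  then show ?thesis using that by (metis ex_in_conv mem_lines_through)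
qed

lemma col_refl: "x \<in> points S \<Longrightarrow> x \<sim> x"
  using ex_line colI by metis

lemma proj_ex:
  assumes "x \<in> points S" "N \<in> lines S"
  obtains y where "on y N" "x \<sim> y"
proof (cases "on x N")
  case True
  then show ?thesis using that colI by blast
next
  case False
  obtain y M where "on x M" "on y M" "on y N"
    using proj_axiom[OF assms False] by (auto elim!: ex1E)
  then show ?thesis using that colI by blast
qed

lemma proj_unique:
  assumes "\<not> on x N" "on y N" "on z N" "x \<sim> y" "x \<sim> z"
  shows "y = z"
proof -
  have "x \<in> points S" "N \<in> lines S" using assms col_point on_line by auto
  note ex1 = proj_axiom[OF this assms(1)]
  obtain M M' where M: "on x M" "on y M" "on x M'" "on z M'"
    using assms(4,5) by (elim colE)
  let ?Q = "\<lambda>(y, M). y \<in> points S \<and> M \<in> lines S \<and> on x M \<and> on y M \<and> on y N"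
  have "?Q (y, M)" "?Q (z, M')" using M assms(2,3) on_line on_point by auto
  then have "(y, M) = (z, M')" using ex1[unfolded Ex1_def] by (elim exE conjE) blast
  then show ?thesis by simp
qed

lemma no_triangle:
  assumes "x \<noteq> y" "on x N" "on y N" "z \<sim> x" "z \<sim> y"
  shows "on z N"
  using proj_unique[of z N x y] assms by auto

lemma finite_points: "finite (points S)"
proof -
  have "lines S \<noteq> {}" using GQ by (simp add: GQ_def)
  then obtain N where N: "N \<in> lines S" by blast
  have "points S \<subseteq> (\<Union>y\<in>points_on S N. \<Union>M\<in>lines_through S y. points_on S M)"
  proof
    fix x assume "x \<in> points S"
    then obtain y where "on y N" "x \<sim> y" using N by (rule proj_ex)
    then show "x \<in> (\<Union>y\<in>points_on S N. \<Union>M\<in>lines_through S y. points_on S M)"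
      by (auto simp: collinear_def intro!: bexI[of _ y])
  qed
  then show ?thesis
    by (rule finite_subset) (intro finite_UN_I finite_points_on finite_lines_through)
qed

lemma ex_other_point:
  assumes "N \<in> lines S" obtains y where "on y N" "y \<noteq> x"
proof -
  have "\<not> points_on S N \<subseteq> {x}"
    using card_points_on[OF assms] s_pos card_mono[of "{x}" "points_on S N"] by auto
  then obtain y where "y \<in> points_on S N" "y \<noteq> x" by blast
  then show ?thesis using that by simp
qed

lemma ex_other_line:
  assumes "x \<in> points S" obtains N where "on x N" "N \<noteq> M"
proof -
  have "\<not> lines_through S x \<subseteq> {M}"
    using card_lines_through[OF assms] t_pos card_mono[of "{M}" "lines_through S x"] by auto
  then obtain N where "N \<in> lines_through S x" "N \<noteq> M" by blast
  then show ?thesis using that by simp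
qed

lemma finite_lines: "finite (lines S)"
proof -
  have "lines S \<subseteq> (\<Union>x\<in>points S. lines_through S x)"
  proof
    fix N assume N: "N \<in> lines S"
    obtain y where "on y N" using ex_other_point[OF N] by blast
    then show "N \<in> (\<Union>x\<in>points S. lines_through S x)" using on_point by auto
  qed
  then show ?thesis
    by (rule finite_subset) (intro finite_UN_I finite_points finite_lines_through)
qed

section \<open>The matrix of common lines and its quadratic form\<close>

definition joins :: "'p \<Rightarrow> 'p \<Rightarrow> real" where
  "joins x y = real (card (lines_through S x \<inter> lines_through S y))"

lemma joins_sym: "joins x y = joins y x"
  by (simp add: joins_def Int_commute)

lemma joins_self: "x \<in> points S \<Longrightarrow> joins x x = real t + 1"
  by (simp add: joins_def card_lines_through)

lemma joins_col: assumes "x \<sim> y" "x \<noteq> y" shows "joins x y = 1"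
proof -
  obtain N where N: "on x N" "on y N" using assms(1) by (rule colE)
  have "lines_through S x \<inter> lines_through S y = {N}"
    using N assms(2) line_eq by (auto; blast)
  then show ?thesis by (simp add: joins_def)
qed

lemma joins_not_col: "\<not> x \<sim> y \<Longrightarrow> joins x y = 0"
  by (auto simp: joins_def card_eq_0_iff disjoint_iff finite_lines_through intro: colI)

lemma joins_eq_sum: "joins x y = (\<Sum>N\<in>lines_through S x. if on y N then 1 else 0)"
proof -
  have "lines_through S x \<inter> lines_through S y = {N \<in> lines_through S x. on y N}" by auto
  then show ?thesis unfolding joins_def
    by (simp add: sum.If_cases finite_lines_through Int_def)
qed

text \<open>Both cases of the projection axiom in one formula: a point off \<open>K\<close> has one
  neighbour on it, while a point on \<open>K\<close> has s others and meets itself on t + 1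
  lines.\<close>

lemma sum_joins_line:
  assumes "y \<in> points S" "K \<in> lines S"
  shows "(\<Sum>x\<in>points_on S K. joins x y) = 1 + (real s + real t) * (if on y K then 1 else 0)"
proof (cases "on y K")
  case True
  have "(\<Sum>x\<in>points_on S K. joins x y) = joins y y + (\<Sum>x\<in>points_on S K - {y}. joins x y)"
    using True by (intro sum.remove) (auto simp: finite_points_on)
  also have "(\<Sum>x\<in>points_on S K - {y}. joins x y) = (\<Sum>x\<in>points_on S K - {y}. 1)"
    using True by (intro sum.cong refl joins_col) (auto intro: colI)
  also have "\<dots> = real s"
    using True card_points_on[OF assms(2)] by (simp add: card_Diff_singleton)
  finally show ?thesis using True joins_self[OF assms(1)] by simp
next
  case False
  obtain z where z: "on z K" "y \<sim> z" using proj_ex assms by blast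
  have "(\<Sum>x\<in>points_on S K. joins x y) = joins z y + (\<Sum>x\<in>points_on S K - {z}. joins x y)"
    using z by (intro sum.remove) (auto simp: finite_points_on)
  also have "(\<Sum>x\<in>points_on S K - {z}. joins x y) = (\<Sum>x\<in>points_on S K - {z}. 0)"
  proof (rule sum.cong[OF refl])
    fix x assume x: "x \<in> points_on S K - {z}"
    then have "\<not> x \<sim> y" using proj_unique[OF False _ z(1) _ z(2), of x] col_sym by auto
    then show "joins x y = 0" by (rule joins_not_col)
  qed
  also have "joins z y = 1" using joins_col[OF z(2)] z False joins_sym by metis
  finally show ?thesis using False by simp
qed

lemma sum_joins_mult:
  assumes "x \<in> points S"
  shows "(\<Sum>z\<in>points S. joins x z * h z) = (\<Sum>N\<in>lines_through S x. \<Sum>z\<in>points_on S N. h z)"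
proof -
  have "(\<Sum>z\<in>points S. joins x z * h z)
      = (\<Sum>z\<in>points S. \<Sum>N\<in>lines_through S x. (if on z N then h z else 0))"
    by (auto simp: joins_eq_sum sum_distrib_right intro!: sum.cong)
  also have "\<dots> = (\<Sum>N\<in>lines_through S x. \<Sum>z\<in>points S. (if on z N then h z else 0))"
    by (rule sum.swap)
  also have "\<dots> = (\<Sum>N\<in>lines_through S x. \<Sum>z\<in>points_on S N. h z)"
  proof (rule sum.cong[OF refl])
    fix N assume "N \<in> lines_through S x"
    have "points S \<inter> {z. on z N} = points_on S N" by (auto simp: points_on_def)
    then show "(\<Sum>z\<in>points S. (if on z N then h z else 0)) = sum h (points_on S N)"
      by (simp add: sum.If_cases finite_points)
  qed
  finally show ?thesis .
qed

lemma sum_joins_point: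
  assumes "x \<in> points S"
  shows "(\<Sum>w\<in>points S. joins x w) = (real s + 1) * (real t + 1)"
proof -
  have "(\<Sum>w\<in>points S. joins x w * 1) = (\<Sum>N\<in>lines_through S x. \<Sum>w\<in>points_on S N. 1)"
    using assms by (rule sum_joins_mult)
  also have "\<dots> = (\<Sum>N\<in>lines_through S x. real s + 1)"
    using on_line by (intro sum.cong refl) (simp add: card_points_on)
  finally show ?thesis using assms by (simp add: card_lines_through)
qed

text \<open>With N the point-line incidence matrix, \<open>joins\<close> is M = N N^T, the adjacency
  matrix plus t + 1 on the diagonal. This is the entry at (x, y) of M^2 = (s + t) M + (t + 1) J with
  J the all-one matrix; on functions of sum zero it leaves only the eigenvalues 0 and s + t.\<close>

lemma sum_joins_joins:
  assumes "x \<in> points S" "y \<in> points S"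
  shows "(\<Sum>z\<in>points S. joins x z * joins z y) = (real s + real t) * joins x y + (real t + 1)"
proof -
  have "(\<Sum>z\<in>points S. joins x z * joins z y)
      = (\<Sum>N\<in>lines_through S x. \<Sum>z\<in>points_on S N. joins z y)"
    using assms by (intro sum_joins_mult) auto
  also have "\<dots> = (\<Sum>N\<in>lines_through S x. 1 + (real s + real t) * (if on y N then 1 else 0))"
    using assms on_line by (intro sum.cong refl sum_joins_line) auto
  also have "\<dots> = (real t + 1) + (real s + real t) * joins x y"
    using assms by (simp add: sum.distrib card_lines_through joins_eq_sum sum_distrib_left)
  finally show ?thesis by simp
qed

definition smear :: "('p \<Rightarrow> real) \<Rightarrow> 'p \<Rightarrow> real" where
  "smear f x = (\<Sum>y\<in>points S. joins x y * f y)"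

lemma sum_smear:
  "(\<Sum>x\<in>points S. smear f x) = (real s + 1) * (real t + 1) * (\<Sum>x\<in>points S. f x)"
proof -
  have "(\<Sum>x\<in>points S. joins x y) = (real s + 1) * (real t + 1)" if "y \<in> points S" for y
    using sum_joins_point[OF that] by (simp add: joins_sym)
  moreover have "(\<Sum>x\<in>points S. smear f x) = (\<Sum>y\<in>points S. (\<Sum>x\<in>points S. joins x y) * f y)"
    unfolding smear_def by (subst sum.swap) (simp add: sum_distrib_right)
  ultimately show ?thesis by (simp add: sum_distrib_left)
qed

text \<open>M is symmetric, so the squared norm of Mf is the quadratic form of M^2; the part J
  contributes the square of the sum of \<open>f\<close>.\<close>

lemma sum_smear_square:
  "(\<Sum>x\<in>points S. (smear f x)\<^sup>2)
    = (real s + real t) * (\<Sum>x\<in>points S. f x * smear f x) + (real t + 1) * (\<Sum>x\<in>points S. f x)\<^sup>2"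
proof -
  have "(\<Sum>x\<in>points S. (smear f x)\<^sup>2)
      = (\<Sum>x\<in>points S. \<Sum>y\<in>points S. \<Sum>z\<in>points S. f y * f z * (joins y x * joins x z))"
    unfolding smear_def power2_eq_square sum_product
    by (intro sum.cong refl) (simp add: joins_sym mult_ac)
  also have "\<dots> = (\<Sum>y\<in>points S. \<Sum>x\<in>points S. \<Sum>z\<in>points S. f y * f z * (joins y x * joins x z))"
    by (rule sum.swap)
  also have "\<dots> = (\<Sum>y\<in>points S. \<Sum>z\<in>points S. \<Sum>x\<in>points S. f y * f z * (joins y x * joins x z))"
    by (intro sum.cong refl sum.swap)
  also have "\<dots> = (\<Sum>y\<in>points S. \<Sum>z\<in>points S.
                     f y * f z * ((real s + real t) * joins y z + (real t + 1)))"
    by (intro sum.cong refl) (simp add: sum_distrib_left[symmetric] sum_joins_joins)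
  also have "\<dots> = (\<Sum>y\<in>points S. (real s + real t) * (f y * smear f y)
                     + (real t + 1) * (f y * (\<Sum>z\<in>points S. f z)))"
    by (intro sum.cong refl) (simp add: smear_def sum_distrib_left sum.distrib[symmetric] algebra_simps)
  also have "\<dots> = (real s + real t) * (\<Sum>x\<in>points S. f x * smear f x)
                     + (real t + 1) * (\<Sum>x\<in>points S. f x)\<^sup>2"
    by (simp add: sum.distrib sum_distrib_left[symmetric] sum_distrib_right[symmetric] power2_eq_square)
  finally show ?thesis .
qed

text \<open>The second largest eigenvalue of the collinearity graph is \<open>s - 1\<close>; \<open>smear\<close> is
  the adjacency operator plus \<open>t + 1\<close>.\<close>

lemma smear_quadratic_bound:
  assumes "(\<Sum>x\<in>points S. f x) = 0"
  shows "(\<Sum>x\<in>points S. f x * smear f x) \<le> (real s + real t) * (\<Sum>x\<in>points S. (f x)\<^sup>2)"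
proof -
  let ?c = "real s + real t"
  \<comment> \<open>On functions of sum zero M^2 = cM, so the squared norm of (M - c)f is c times
    the difference to be bounded.\<close>
  have "0 \<le> (\<Sum>x\<in>points S. (smear f x - ?c * f x)\<^sup>2)" by (intro sum_nonneg) auto
  also have "\<dots> = (\<Sum>x\<in>points S. (smear f x)\<^sup>2 - (2 * ?c) * (f x * smear f x) + (?c * ?c) * (f x)\<^sup>2)"
    by (intro sum.cong refl) (simp add: power2_eq_square algebra_simps)
  also have "\<dots> = ?c * (?c * (\<Sum>x\<in>points S. (f x)\<^sup>2) - (\<Sum>x\<in>points S. f x * smear f x))"
    unfolding sum.distrib sum_subtractf sum_distrib_left[symmetric] sum_smear_square assms
    by (simp add: algebra_simps)
  finally show ?thesis using s_pos by (simp add: zero_le_mult_iff)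
qed

text \<open>The constant 1 is an eigenfunction with eigenvalue (s + 1)(t + 1). The quadratic
  identity at this function is an equation for the number v of points, from which the nonzero factor
  v (t + 1) cancels.\<close>

lemma card_points: "real (card (points S)) = (real s + 1) * (real s * real t + 1)"
proof -
  define v where "v = real (card (points S))"
  have sm: "smear (\<lambda>_. 1) x = (real s + 1) * (real t + 1)" if "x \<in> points S" for x
    using sum_joins_point[OF that] by (simp add: smear_def)
  have "v * ((real s + 1) * (real t + 1))\<^sup>2
      = (real s + real t) * (v * ((real s + 1) * (real t + 1))) + (real t + 1) * v\<^sup>2"
    using sum_smear_square[of "\<lambda>_. 1"] by (simp add: sm v_def)
  then have "(v * (real t + 1)) * ((real s + 1)\<^sup>2 * (real t + 1) - (real s + real t) * (real s + 1) - v) = 0"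
    by (simp add: power2_eq_square algebra_simps)
  moreover have "v > 0" unfolding v_def
    using GQ finite_points by (simp add: GQ_def card_gt_0_iff)
  ultimately have "v = (real s + 1)\<^sup>2 * (real t + 1) - (real s + real t) * (real s + 1)" by simp
  then show ?thesis unfolding v_def by (simp add: power2_eq_square algebra_simps)
qed

section \<open>Centers of triads\<close>

definition perp :: "'p \<Rightarrow> 'p set" where
  "perp x = {y. y \<sim> x}"

lemma mem_perp [simp]: "y \<in> perp x \<longleftrightarrow> y \<sim> x"
  by (simp add: perp_def)

lemma perp_subset: "perp x \<subseteq> points S"
  using col_point by auto

lemma finite_perp [simp]: "finite (perp x)"
  using finite_subset[OF perp_subset finite_points] .

lemma joins_nonzero: "joins x y \<noteq> 0 \<Longrightarrow> x \<sim> y \<and> y \<sim> x"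
  using joins_not_col col_sym by blast

lemma card_perp:
  assumes "x \<in> points S"
  shows "real (card (perp x)) = 1 + real s * (real t + 1)"
proof -
  have x: "x \<in> perp x" using assms col_refl by simp
  have "(\<Sum>w\<in>points S. joins x w) = (\<Sum>w\<in>perp x. joins x w)"
  proof (intro sum.mono_neutral_right finite_points perp_subset ballI)
    fix i assume "i \<in> points S - perp x"
    then show "joins x i = 0" using joins_nonzero[of x i] by auto
  qed
  also have "\<dots> = joins x x + (\<Sum>w\<in>perp x - {x}. joins x w)"
    using x by (intro sum.remove) auto
  also have "(\<Sum>w\<in>perp x - {x}. joins x w) = (\<Sum>w\<in>perp x - {x}. 1)"
    using joins_col col_sym by (intro sum.cong refl) auto
  also have "\<dots> = real (card (perp x)) - 1"
    using x card_Suc_Diff1[OF finite_perp x] by simp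
  finally show ?thesis using sum_joins_point[OF assms] joins_self[OF assms]
    by (simp add: algebra_simps)
qed

text \<open>The entry of M^2 at a pair where M vanishes is t + 1, and each common neighbour
  contributes 1 to it.\<close>

lemma card_common_perp:
  assumes "x \<in> points S" "y \<in> points S" "\<not> x \<sim> y"
  shows "card (perp x \<inter> perp y) = t + 1"
proof -
  have "(\<Sum>z\<in>points S. joins x z * joins z y) = (\<Sum>z\<in>perp x \<inter> perp y. joins x z * joins z y)"
    using perp_subset by (intro sum.mono_neutral_right finite_points) (auto dest: joins_nonzero)
  also have "\<dots> = (\<Sum>z\<in>perp x \<inter> perp y. 1)"
  proof (rule sum.cong[OF refl])
    fix z assume z: "z \<in> perp x \<inter> perp y"
    then have "z \<noteq> x" "z \<noteq> y" using assms col_sym by auto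
    then show "joins x z * joins z y = 1" using z joins_col[of x z] joins_col[of z y] col_sym[of z x] by auto
  qed
  finally have "real (card (perp x \<inter> perp y)) = real t + 1"
    using sum_joins_joins[OF assms(1,2)] joins_not_col[OF assms(3)] by simp
  then show ?thesis by simp
qed

lemma perp_pair_not_col:
  assumes "\<not> x \<sim> y" "u \<in> perp x \<inter> perp y" "v \<in> perp x \<inter> perp y" "u \<noteq> v"
  shows "\<not> u \<sim> v"
proof
  assume "u \<sim> v"
  then obtain N where N: "on u N" "on v N" by (rule colE)
  then have "on x N" "on y N"
    using no_triangle[OF assms(4) N] assms(2,3) col_sym by auto
  then show False using assms(1) colI by blast
qed

text \<open>If \<open>w\<close> differs from \<open>x\<close>, its only neighbour among the centers
  is the point of the line \<open>w x\<close> collinear with \<open>y\<close>. The value equals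
  \<open>joins w x\<close>, so the function used for triads is smeared to 0 at points collinear with
  exactly one of \<open>x\<close>, \<open>y\<close>.\<close>

lemma sum_joins_centers:
  assumes xy: "\<not> x \<sim> y" and w: "w \<sim> x" "\<not> w \<sim> y" and y: "y \<in> points S"
  shows "(\<Sum>u\<in>perp x \<inter> perp y. joins w u) = (if w = x then real t + 1 else 1)"
proof -
  have x: "x \<in> points S" using w col_point col_sym by blast
  show ?thesis
  proof (cases "w = x")
    case True
    have "(\<Sum>u\<in>perp x \<inter> perp y. joins w u) = (\<Sum>u\<in>perp x \<inter> perp y. 1)"
    proof (rule sum.cong[OF refl])
      fix u assume "u \<in> perp x \<inter> perp y"
      then show "joins w u = 1" using True xy joins_col[of x u] col_sym[of u x] by auto
    qed
    then show ?thesis using True card_common_perp[OF x y xy] by simp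
  next
    case False
    obtain N where N: "on w N" "on x N" using w(1) by (rule colE)
    obtain v where v: "on v N" "y \<sim> v" using proj_ex[OF y on_line[OF N(1)]] .
    have v': "v \<in> perp x \<inter> perp y" "v \<noteq> w" "w \<sim> v"
      using v N w(2) col_sym[of y v] colI by auto
    have "(\<Sum>u\<in>perp x \<inter> perp y. joins w u)
        = joins w v + (\<Sum>u\<in>perp x \<inter> perp y - {v}. joins w u)"
      using v' by (intro sum.remove) auto
    also have "(\<Sum>u\<in>perp x \<inter> perp y - {v}. joins w u) = (\<Sum>u\<in>perp x \<inter> perp y - {v}. 0)"
    proof (rule sum.cong[OF refl])
      fix u assume u: "u \<in> perp x \<inter> perp y - {v}"
      have "\<not> w \<sim> u"
      proof
        assume "w \<sim> u"
        then have "on u N" using no_triangle[OF False N, of u] u col_sym by auto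
        then have "u \<sim> v" using v colI by auto
        then show False using perp_pair_not_col[OF xy, of u v] u v' by auto
      qed
      then show "joins w u = 0" by (rule joins_not_col)
    qed
    also have "joins w v = 1" using v' joins_col by auto
    finally show ?thesis using False by simp
  qed
qed

text \<open>The function \<open>1\<^sub>X - e\<^sub>x - e\<^sub>y\<close>, with \<open>X\<close> the set of centers of the pair, is smeared to the number
  of centers on the points collinear with neither of \<open>x\<close> and \<open>y\<close>; its first two moments
  show that this number has variance zero when \<open>t = s\<^sup>2\<close>.\<close>

theorem card_triad_centers:
  assumes ts: "t = s\<^sup>2"
    and P: "x \<in> points S" "y \<in> points S" "z \<in> points S"
    and nc: "\<not> x \<sim> y" "\<not> z \<sim> x" "\<not> z \<sim> y"
  shows "card (perp x \<inter> perp y \<inter> perp z) = s + 1"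
proof -
  let ?X = "perp x \<inter> perp y"
  let ?W = "points S - (perp x \<union> perp y)"
  let ?T = "real t" and ?s = "real s"
  have nc': "\<not> y \<sim> x" using nc(1) col_sym by blast
  have xy: "x \<noteq> y" using nc(1) P col_refl by auto
  have xX: "x \<notin> ?X" "y \<notin> ?X" using nc(1) nc' by auto
  define c where "c w = real (card (?X \<inter> perp w))" for w
  define f where "f w = (if w \<in> ?X then 1 else 0) - (if w = x then 1 else 0) - (if w = y then 1 else (0::real))" for w
  have cardX: "real (card ?X) = ?T + 1" using card_common_perp[OF P(1,2) nc(1)] by simp
  have sub: "?X \<subseteq> points S" using perp_subset by blast
  have split: "sum (\<lambda>w. h w * f w) (points S) = sum h ?X - h x - h y" for h :: "'p \<Rightarrow> real"
  proof -
    have "sum (\<lambda>w. h w * f w) (points S)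
        = (\<Sum>w\<in>points S. if w \<in> ?X then h w else 0) - (\<Sum>w\<in>points S. if w = x then h w else 0)
           - (\<Sum>w\<in>points S. if w = y then h w else 0)"
      unfolding sum_subtractf[symmetric] f_def by (intro sum.cong refl) auto
    also have "(\<Sum>w\<in>points S. if w \<in> ?X then h w else 0) = sum h ?X"
      using sub by (subst sum.inter_restrict[symmetric]) (auto simp: finite_points Int_absorb1 inf_absorb2)
    finally show ?thesis using P by (simp add: finite_points)
  qed
  have sm: "smear f w = (\<Sum>u\<in>?X. joins w u) - joins w x - joins w y" for w
    unfolding smear_def by (rule split)
  have smW: "smear f w = c w" if w: "w \<in> ?W" for w
  proof -
    have "(\<Sum>u\<in>?X. joins w u) = (\<Sum>u\<in>?X. if u \<in> perp w then 1 else 0)"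
    proof (rule sum.cong[OF refl])
      fix u assume "u \<in> ?X"
      then show "joins w u = (if u \<in> perp w then 1 else 0)"
        using w joins_col[of w u] joins_not_col[of w u] col_sym[of w u] col_sym[of u w] by auto
    qed
    also have "\<dots> = c w" unfolding c_def
      by (subst sum.inter_restrict[symmetric]) auto
    finally show ?thesis using w sm joins_not_col by simp
  qed
  have smx: "smear f w = 0" if w: "w \<in> perp x - perp y" for w
  proof -
    have "joins w x = (if w = x then ?T + 1 else 1)" using w joins_self[OF P(1)] joins_col by auto
    moreover have "joins w y = 0" using w joins_not_col by auto
    ultimately show ?thesis using sm sum_joins_centers[OF nc(1) _ _ P(2), of w] w by simp
  qed
  have smy: "smear f w = 0" if w: "w \<in> perp y - perp x" for w
  proof -
    have "joins w y = (if w = y then ?T + 1 else 1)" using w joins_self[OF P(2)] joins_col by auto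
    moreover have "joins w x = 0" using w joins_not_col by auto
    ultimately show ?thesis using sm sum_joins_centers[OF nc' _ _ P(1), of w] w
      by (simp add: Int_commute)
  qed
  have smX: "smear f w = ?T - 1" if w: "w \<in> ?X" for w
  proof -
    have "(\<Sum>u\<in>?X. joins w u) = joins w w + (\<Sum>u\<in>?X - {w}. joins w u)"
      using w by (intro sum.remove) auto
    also have "(\<Sum>u\<in>?X - {w}. joins w u) = (\<Sum>u\<in>?X - {w}. 0)"
      using w perp_pair_not_col[OF nc(1) w] by (intro sum.cong refl joins_not_col) auto
    also have "joins w w = ?T + 1" using w sub joins_self by auto
    finally show ?thesis using sm joins_col[of w x] joins_col[of w y] w xX by fastforce
  qed
  have parts: "sum h (points S) = sum h ?W + sum h (perp x - perp y) + sum h (perp y - perp x) + sum h ?X"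
    for h :: "'p \<Rightarrow> real"
  proof -
    have "points S = ((?W \<union> (perp x - perp y)) \<union> (perp y - perp x)) \<union> ?X" using perp_subset by blast
    then have "sum h (points S) = sum h (((?W \<union> (perp x - perp y)) \<union> (perp y - perp x)) \<union> ?X)" by simp
    also have "\<dots> = sum h ?W + sum h (perp x - perp y) + sum h (perp y - perp x) + sum h ?X"
      using finite_points by (subst sum.union_disjoint, auto)+
    finally show ?thesis .
  qed
  have "sum (\<lambda>_. 1) (points S) = sum (\<lambda>_. 1::real) ?W + sum (\<lambda>_. 1) (perp x - perp y)
      + sum (\<lambda>_. 1) (perp y - perp x) + sum (\<lambda>_. 1) ?X" by (rule parts)
  moreover have "real (card (perp x - perp y)) = ?s * (?T + 1) - ?T"
    using card_perp[OF P(1)] cardX card_Diff_subset_Int[of "perp x" "perp y"]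
      card_mono[of "perp x" ?X] by (simp add: of_nat_diff)
  moreover have "real (card (perp y - perp x)) = ?s * (?T + 1) - ?T"
    using card_perp[OF P(2)] cardX card_Diff_subset_Int[of "perp y" "perp x"]
      card_mono[of "perp y" ?X] by (simp add: of_nat_diff Int_commute)
  ultimately have cardW: "real (card ?W) = (?s + 1) * (?s * ?T + 1) - 2 * (?s * (?T + 1) - ?T) - (?T + 1)"
    using card_points cardX by simp
  have f0: "sum f (points S) = ?T - 1" using split[of "\<lambda>_. 1"] cardX by simp
  \<comment> \<open>The total is (s + 1)(t + 1)(t - 1); the t + 1 centers, each of value t - 1, take
    away (t + 1)(t - 1).\<close>
  have sum1: "sum c ?W = ?s * (?T + 1) * (?T - 1)"
    using sum_smear[of f] parts[of "smear f"] smW smx smy smX cardX f0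
    by (simp add: algebra_simps)
  have "(\<Sum>w\<in>points S. smear f w * f w) = (?T + 1) * (?T - 1)"
  proof -
    have "smear f x = 0" "smear f y = 0" using smx[of x] smy[of y] P nc(1) nc' col_refl by auto
    then show ?thesis using split[of "smear f"] smX cardX by simp
  qed
  then have "(\<Sum>w\<in>points S. (smear f w)\<^sup>2) = (?s + ?T) * ((?T + 1) * (?T - 1)) + (?T + 1) * (?T - 1)\<^sup>2"
    using sum_smear_square[of f] f0 by (simp add: mult.commute)
  then have sum2: "(\<Sum>w\<in>?W. (c w)\<^sup>2) = (?s + ?T) * ((?T + 1) * (?T - 1))"
    using parts[of "\<lambda>w. (smear f w)\<^sup>2"] smW smx smy smX cardX by simp
  \<comment> \<open>For t = s^2 the set \<open>?W\<close> has s(s - 1)(s^2 + 1) elements, and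
    \<open>c\<close> has mean s + 1 and mean square (s + 1)^2 on it.\<close>
  have "(\<Sum>w\<in>?W. (c w - (?s + 1))\<^sup>2)
      = (\<Sum>w\<in>?W. (c w)\<^sup>2 - 2 * (?s + 1) * c w + (?s + 1)\<^sup>2)"
    by (intro sum.cong refl) (simp add: power2_eq_square algebra_simps)
  also have "\<dots> = (\<Sum>w\<in>?W. (c w)\<^sup>2) - 2 * (?s + 1) * sum c ?W + real (card ?W) * (?s + 1)\<^sup>2"
    by (simp add: sum.distrib sum_subtractf sum_distrib_left)
  also have "\<dots> = 0"
    unfolding sum1 sum2 cardW ts of_nat_power by algebra
  finally have "\<forall>w\<in>?W. (c w - (?s + 1))\<^sup>2 = 0"
    using finite_points by (subst (asm) sum_nonneg_eq_0_iff) auto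
  then have "c z = ?s + 1" using P(3) nc by simp
  then show ?thesis by (simp add: c_def)
qed

section \<open>From collineations to automorphisms\<close>

lemma points_on_inject:
  assumes "M \<in> lines S" "points_on S M = points_on S N"
  shows "M = N"
proof -
  obtain x where x: "on x M" using ex_other_point[OF assms(1)] by blast
  obtain y where y: "on y M" "y \<noteq> x" using ex_other_point[OF assms(1)] .
  have "on x N" "on y N" using x y assms(2) mem_points_on by blast+
  then show ?thesis using line_eq x y by metis
qed

text \<open>The images of two points of a line span a line, which contains the images of all the
  others because there are no triangles; equal sizes make it the full image.\<close>

lemma collineation_imp_automorphism:
  assumes f: "f permutes points S"
    and col: "\<And>x y. x \<in> points S \<Longrightarrow> y \<in> points S \<Longrightarrow> f x \<sim> f y \<longleftrightarrow> x \<sim> y"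
  obtains g where "automorphism S f g" "\<And>N. N \<in> lines S \<Longrightarrow> points_on S (g N) = f ` points_on S N"
proof -
  have inj: "inj f" using f by (rule permutes_inj)
  have ex: "\<exists>K\<in>lines S. points_on S K = f ` points_on S N" if N: "N \<in> lines S" for N
  proof -
    obtain x where x: "on x N" using ex_other_point[OF N] by blast
    obtain y where y: "on y N" "y \<noteq> x" using ex_other_point[OF N] .
    have "f x \<sim> f y" using x y col colI on_point by metis
    then obtain K where K: "on (f x) K" "on (f y) K" by (rule colE)
    have fxy: "f x \<noteq> f y" using inj y by (auto dest: injD)
    have "on (f z) K" if z: "on z N" for z
    proof -
      have "f z \<sim> f x" "f z \<sim> f y" using x y z col colI on_point by metis+
      then show ?thesis using no_triangle[OF fxy K] by blast
    qed
    then have "f ` points_on S N \<subseteq> points_on S K" by auto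
    moreover have "card (f ` points_on S N) = card (points_on S K)"
      using card_image[OF inj_on_subset[OF inj]] card_points_on N on_line[OF K(1)] by simp
    ultimately have "f ` points_on S N = points_on S K" by (intro card_subset_eq finite_points_on)
    then show ?thesis using on_line[OF K(1)] by metis
  qed
  \<comment> \<open>The value \<open>N\<close> off the carrier is what \<open>permutes\<close>
    requires.\<close>
  define g where "g N = (if N \<in> lines S then SOME K. K \<in> lines S \<and> points_on S K = f ` points_on S N else N)" for N
  have g: "g N \<in> lines S" "points_on S (g N) = f ` points_on S N" if "N \<in> lines S" for N
    using someI_ex[of "\<lambda>K. K \<in> lines S \<and> points_on S K = f ` points_on S N"] ex[OF that] that
    unfolding g_def by auto
  have "inj_on g (lines S)"
  proof (rule inj_onI)
    fix M N assume MN: "M \<in> lines S" "N \<in> lines S" "g M = g N"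
    then have "f ` points_on S M = f ` points_on S N" using g(2)[OF MN(1)] g(2)[OF MN(2)] by simp
    then show "M = N" using points_on_inject[OF MN(1)] by (simp only: inj_image_eq_iff[OF inj])
  qed
  then have "bij_betw g (lines S) (lines S)"
    unfolding bij_betw_def using g(1) finite_lines by (simp add: endo_inj_surj image_subsetI)
  then have "g permutes lines S" by (rule bij_imp_permutes) (simp add: g_def)
  moreover have "on (f x) (g N) \<longleftrightarrow> on x N" if "x \<in> points S" "N \<in> lines S" for x N
  proof -
    have "on (f x) (g N) \<longleftrightarrow> f x \<in> f ` points_on S N" using g(2)[OF that(2)] mem_points_on by metis
    then show ?thesis using inj_image_mem_iff[OF inj] by simp
  qed
  ultimately have "automorphism S f g" using f by (simp add: automorphism_def)
  then show ?thesis using that g(2) by blast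
qed

end

section \<open>Subtended ovoids and twins\<close>

locale doubly_subtended_pair = generalized_quadrangle S s "s\<^sup>2"
  for S :: "('p, 'l) geometry" and s :: nat +
  fixes S' :: "('p, 'l) geometry"
  assumes s_gt_1: "s > 1"
    and sub: "subquadrangle S' S s s"
    and doubly: "\<forall>O'\<in>subtended_ovoids S S'. doubly_subtended S S' O'"
begin

sublocale sub: generalized_quadrangle S' s s
  using sub by unfold_locales (simp add: subquadrangle_def)

abbreviation A :: "'p set" where "A \<equiv> points S - points S'"
abbreviation ovoid :: "'p \<Rightarrow> 'p set" where "ovoid \<equiv> subtended_by S S'"

lemma sub_points: "points S' \<subseteq> points S" and sub_lines: "lines S' \<subseteq> lines S"
  and sub_inc: "sub.on x N \<longleftrightarrow> on x N \<and> x \<in> points S' \<and> N \<in> lines S'"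
  using sub by (auto simp: subquadrangle_def)

lemma mem_ovoid [simp]: "z \<in> ovoid x \<longleftrightarrow> z \<in> points S' \<and> x \<sim> z"
  by (auto simp: subtended_by_def)

text \<open>Lines have s + 1 points in both quadrangles, so a line of \<open>S'\<close> gains no
  point in \<open>S\<close>.\<close>

lemma sub_line_points: assumes "N \<in> lines S'" "on x N" shows "x \<in> points S'"
proof -
  have "points_on S' N \<subseteq> points_on S N" using sub_inc by auto
  then have "points_on S' N = points_on S N"
    using assms(1) sub_lines card_points_on[of N] sub.card_points_on[of N] finite_points_on
    by (intro card_subset_eq) auto
  moreover have "x \<in> points_on S N" using assms by simp
  ultimately have "x \<in> points_on S' N" by simp
  then show ?thesis using sub_inc by simp
qed

text \<open>For a line \<open>M\<close> of \<open>S'\<close> through \<open>v\<close>, the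
  projection of \<open>u\<close> onto \<open>M\<close> inside \<open>S'\<close> is also its
  projection in \<open>S\<close>, which is \<open>v\<close>; so the line \<open>u v\<close> is found
  in \<open>S'\<close>.\<close>

lemma sub_lineI:
  assumes "u \<noteq> v" "u \<in> points S'" "v \<in> points S'" "on u N" "on v N"
  shows "N \<in> lines S'"
proof -
  obtain M where M: "sub.on v M" using sub.ex_line[OF assms(3)] .
  show ?thesis
  proof (cases "on u M")
    case True
    then show ?thesis using M line_eq[OF assms(4,5), of M] sub_inc assms(1) by auto
  next
    case False
    obtain w where w: "sub.on w M" "collinear S' u w"
      using sub.proj_ex[OF assms(2) sub.on_line[OF M]] .
    then obtain K where K: "sub.on u K" "sub.on w K" by (elim sub.colE)
    have "w = v"
      by (rule proj_unique[OF False]) (use w K M assms(4,5) sub_inc colI in auto)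
    then show ?thesis using K line_eq[OF assms(4,5), of K] sub_inc assms(1) by auto
  qed
qed

lemma sub_colE:
  assumes "u \<noteq> v" "u \<in> points S'" "v \<in> points S'" "u \<sim> v"
  shows "collinear S' u v"
proof -
  obtain N where N: "on u N" "on v N" using assms(4) by (rule colE)
  then have "N \<in> lines S'" using sub_lineI assms by blast
  then show ?thesis using sub.colI[of u N v] N sub_inc assms by auto
qed

lemma card_sub_lines: "card (lines S') = card (points S')"
proof -
  have "(\<Sum>u\<in>points S'. card {N\<in>lines S'. sub.on u N}) = (s + 1) * card (lines S')"
    using sub.card_points_on unfolding points_on_def
    by (intro sum_multicount sub.finite_points sub.finite_lines) auto
  moreover have "(\<Sum>u\<in>points S'. card {N\<in>lines S'. sub.on u N}) = (\<Sum>u\<in>points S'. s + 1)"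
    using sub.card_lines_through unfolding lines_through_def by (intro sum.cong) auto
  ultimately have "(s + 1) * card (lines S') = (s + 1) * card (points S')"
    by (simp add: mult.commute)
  then show ?thesis by (subst (asm) mult_left_cancel) auto
qed

lemma finite_ovoid: "finite (ovoid x)"
  by (rule finite_subset[OF _ sub.finite_points]) auto

text \<open>Projecting \<open>x\<close> onto a line of \<open>S'\<close> shows that the line meets
  \<open>ovoid x\<close> exactly once; the size follows by counting incident pairs.\<close>

lemma card_ovoid:
  assumes x: "x \<in> A"
  shows "card (ovoid x) = s\<^sup>2 + 1"
proof -
  have "(\<Sum>u\<in>ovoid x. card {N\<in>lines S'. sub.on u N}) = 1 * card (lines S')"
  proof (intro sum_multicount finite_ovoid sub.finite_lines ballI)
    fix N assume N: "N \<in> lines S'"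
    have xN: "\<not> on x N" using N sub_line_points x by auto
    have "x \<in> points S" "N \<in> lines S" using x N sub_lines by auto
    then obtain u where u: "on u N" "x \<sim> u" by (rule proj_ex)
    have "v = u" if "v \<in> ovoid x" "sub.on v N" for v
      using that proj_unique[OF xN _ u(1) _ u(2), of v] sub_inc by simp
    moreover have "u \<in> ovoid x" "sub.on u N" using u N sub_line_points[OF N] sub_inc by simp_all
    ultimately have "{u \<in> ovoid x. sub.on u N} = {u}" by blast
    then show "card {u \<in> ovoid x. sub.on u N} = 1" by simp
  qed
  moreover have "(\<Sum>u\<in>ovoid x. card {N\<in>lines S'. sub.on u N}) = (\<Sum>u\<in>ovoid x. s + 1)"
    using sub.card_lines_through unfolding lines_through_def by (intro sum.cong) auto
  ultimately have "real (card (ovoid x) * (s + 1)) = (real s + 1) * (real s * real s + 1)"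
    using card_sub_lines sub.card_points by simp
  then have "real ((s + 1) * card (ovoid x)) = real ((s + 1) * (s\<^sup>2 + 1))"
    by (simp add: power2_eq_square algebra_simps)
  then have "(s + 1) * card (ovoid x) = (s + 1) * (s\<^sup>2 + 1)" by (simp only: of_nat_eq_iff)
  then show ?thesis by (subst (asm) mult_left_cancel) auto
qed

text \<open>The s^2 + 1 points of \<open>ovoid x\<close> lie on distinct lines through
  \<open>x\<close>, since a line with two of them would belong to \<open>S'\<close>. There are only
  s^2 + 1 lines through \<open>x\<close>, so all of them are used.\<close>

lemma base_ex1:
  assumes x: "x \<in> A" and N: "on x N"
  shows "\<exists>!u. u \<in> points S' \<and> on u N"
proof -
  have N': "N \<notin> lines S'" using x N sub_line_points by blast
  define l where "l u = (SOME M. on x M \<and> on u M)" for u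
  have l: "on x (l u)" "on u (l u)" if "u \<in> ovoid x" for u
    using that someI_ex[of "\<lambda>M. on x M \<and> on u M"] unfolding l_def by (auto elim: colE)
  have inj: "inj_on l (ovoid x)"
  proof (rule inj_onI, rule ccontr)
    fix u v assume uv: "u \<in> ovoid x" "v \<in> ovoid x" "l u = l v" "u \<noteq> v"
    moreover have "on v (l u)" using l(2)[OF uv(2)] uv(3) by simp
    ultimately have "l u \<in> lines S'" using l(2)[OF uv(1)] sub_lineI[of u v "l u"] by simp
    then show False using l uv x sub_line_points by auto
  qed
  have "l ` ovoid x = lines_through S x"
    using card_image[OF inj] card_ovoid[OF x] card_lines_through[of x] x l
    by (intro card_subset_eq finite_lines_through) auto
  then obtain u where "u \<in> ovoid x" "l u = N" using N by (metis imageE mem_lines_through)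
  then have "u \<in> points S'" "on u N" using l by auto
  then show ?thesis using sub_lineI N' by blast
qed

definition base :: "'l \<Rightarrow> 'p" where
  "base N = (THE u. u \<in> points S' \<and> on u N)"

lemma base: assumes "x \<in> A" "on x N" shows "base N \<in> points S'" "on (base N) N"
  using theI'[OF base_ex1[OF assms]] unfolding base_def by auto

lemma base_unique: "x \<in> A \<Longrightarrow> on x N \<Longrightarrow> u \<in> points S' \<Longrightarrow> on u N \<Longrightarrow> u = base N"
  using base_ex1[of x N] base[of x N] by blast

lemma A_line: "x \<in> A \<Longrightarrow> on x N \<Longrightarrow> N \<in> lines S - lines S'"
  using on_line sub_line_points by auto

lemma line_A:
  assumes "N \<in> lines S - lines S'"
  obtains x where "x \<in> A" "on x N"
proof -
  obtain y z where yz: "on y N" "on z N" "y \<noteq> z" using ex_other_point assms by (metis DiffD1)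
  then show ?thesis using sub_lineI[of y z N] that assms on_point[of y] on_point[of z] by blast
qed

section \<open>Twins and collinearity\<close>

lemma twin_ex1:
  assumes "x \<in> A"
  shows "\<exists>!y. y \<in> A \<and> y \<noteq> x \<and> ovoid y = ovoid x"
proof -
  have "ovoid x \<in> subtended_ovoids S S'" using assms by (auto simp: subtended_ovoids_def)
  then have "card {y \<in> A. ovoid y = ovoid x} = 2"
    using doubly by (simp add: doubly_subtended_def)
  then obtain a b where ab: "{y \<in> A. ovoid y = ovoid x} = {a, b}" "a \<noteq> b"
    by (metis card_2_iff)
  then have "x = a \<or> x = b" using assms by blast
  then show ?thesis using ab by (elim disjE; intro ex1I[of _ "if x = a then b else a"]) auto
qed

definition twin :: "'p \<Rightarrow> 'p" where
  "twin x = (THE y. y \<in> A \<and> y \<noteq> x \<and> ovoid y = ovoid x)"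

lemma twin: assumes "x \<in> A" shows "twin x \<in> A" "twin x \<noteq> x" "ovoid (twin x) = ovoid x"
  using theI'[OF twin_ex1[OF assms]] unfolding twin_def by auto

lemma twin_unique: "x \<in> A \<Longrightarrow> y \<in> A \<Longrightarrow> ovoid y = ovoid x \<Longrightarrow> y = x \<or> y = twin x"
  using twin_ex1[of x] twin[of x] by blast

lemma twin_twin [simp]: "x \<in> A \<Longrightarrow> twin (twin x) = x"
  using twin_unique[of "twin x" x] twin[of x] by auto

text \<open>If they were collinear, the base of a second line through \<open>x\<close> would form a
  triangle with \<open>x\<close> and \<open>y\<close>.\<close>

lemma not_col_same_ovoid:
  assumes "x \<in> A" "y \<in> A" "x \<noteq> y" "ovoid x = ovoid y"
  shows "\<not> x \<sim> y"
proof
  assume "x \<sim> y"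
  then obtain N where N: "on x N" "on y N" by (rule colE)
  obtain M where M: "on x M" "M \<noteq> N" using ex_other_line assms(1) by blast
  have u: "base M \<in> ovoid x" using base[OF assms(1) M(1)] M colI by auto
  then have "base M \<sim> x" "base M \<sim> y" using assms(4) col_sym mem_ovoid by blast+
  then have "on (base M) N" using no_triangle[OF assms(3) N] by blast
  moreover have "base M \<noteq> x" using u assms(1) by auto
  ultimately show False using M N base[OF assms(1) M(1)] line_eq by blast
qed

lemma not_col_twin: "x \<in> A \<Longrightarrow> \<not> x \<sim> twin x"
  using not_col_same_ovoid[of x "twin x"] twin[of x] by auto

text \<open>Non-collinear points have s^2 + 1 common neighbours, and the shared ovoid already has
  this size.\<close>

lemma common_perp_twin:
  assumes x: "x \<in> A"
  shows "perp x \<inter> perp (twin x) = ovoid x"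
proof -
  have "ovoid x \<subseteq> perp x \<inter> perp (twin x)"
    using twin(3)[OF x] col_sym by (metis (no_types, lifting) IntI mem_ovoid mem_perp subsetI)
  moreover have "card (perp x \<inter> perp (twin x)) = s\<^sup>2 + 1"
    using x twin[OF x] not_col_twin by (intro card_common_perp) auto
  ultimately show ?thesis using card_ovoid[OF x]
    by (intro card_subset_eq[symmetric]) auto
qed

text \<open>The common neighbours of twins all lie in \<open>S'\<close>. This is what tells the two
  sheets apart in all later lifting arguments.\<close>

lemma col_twin_False:
  assumes "x \<in> A" "y \<in> A" "x \<sim> y" "x \<sim> twin y"
  shows False
proof -
  have "x \<in> perp y \<inter> perp (twin y)" using assms by simp
  then have "x \<in> ovoid y" unfolding common_perp_twin[OF assms(2)] .
  then show False using assms(1) by simp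
qed

lemma ovoid_Int_col:
  assumes x: "x \<in> A" and y: "y \<in> A" and xy: "x \<noteq> y" and N: "on x N" "on y N"
  shows "ovoid x \<inter> ovoid y = {base N}"
proof
  show "{base N} \<subseteq> ovoid x \<inter> ovoid y" using base[OF x N(1)] N colI by auto
  show "ovoid x \<inter> ovoid y \<subseteq> {base N}"
  proof
    fix u assume "u \<in> ovoid x \<inter> ovoid y"
    then have "u \<in> points S'" "on u N" using no_triangle[OF xy N, of u] col_sym by auto
    then show "u \<in> {base N}" using base_unique[OF x N(1)] by simp
  qed
qed

text \<open>The two ovoids meet in the set of centers of the triad \<open>x\<close>,
  \<open>twin x\<close>, \<open>y\<close>.\<close>

lemma card_ovoid_Int:
  assumes x: "x \<in> A" and y: "y \<in> A" and nc: "\<not> y \<sim> x" "\<not> y \<sim> twin x"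
  shows "card (ovoid x \<inter> ovoid y) = s + 1"
proof -
  have "card (perp x \<inter> perp (twin x) \<inter> perp y) = s + 1"
    using x y nc twin(1)[OF x] not_col_twin[OF x] by (intro card_triad_centers[OF refl]) simp_all
  moreover have "perp x \<inter> perp (twin x) \<inter> perp y = ovoid x \<inter> ovoid y"
    unfolding common_perp_twin[OF x] using col_sym by auto
  ultimately show ?thesis by simp
qed

text \<open>The ovoids of distinct collinear points meet in one point, whereas non-collinear twins
  would make the same ovoids meet in s + 1 points.\<close>

lemma twin_col:
  assumes x: "x \<in> A" and y: "y \<in> A" and xy: "x \<sim> y"
  shows "twin x \<sim> twin y"
proof (cases "x = y")
  case True
  then show ?thesis using col_refl twin x by auto
next
  case False
  obtain N where N: "on x N" "on y N" using xy by (rule colE)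
  show ?thesis
  proof (rule ccontr)
    assume "\<not> twin x \<sim> twin y"
    then have "card (ovoid x \<inter> ovoid (twin y)) = s + 1"
      using col_twin_False[OF x y xy] x y twin(1) col_sym by (intro card_ovoid_Int) blast+
    then show False using ovoid_Int_col[OF x y False N] twin(3)[OF y] s_gt_1 by simp
  qed
qed

lemma twin_col_swap:
  assumes "x \<in> A" "y \<in> A"
  shows "twin x \<sim> y \<longleftrightarrow> x \<sim> twin y"
  using twin_col[of "twin x" y] twin_col[of x "twin y"] assms twin(1) by auto

text \<open>Supplies triangles of \<E>: the ovoids of \<open>p\<close>, \<open>q\<close>,
  \<open>r\<close> are pairwise on a common line, but the path \<open>p\<close>, \<open>q\<close>,
  \<open>r\<close> continues to \<open>twin p\<close> instead of \<open>p\<close>.\<close>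

lemma twin_proj:
  assumes p: "p \<in> A" and q: "q \<in> A" and pq: "p \<sim> q" and N: "on q N" "\<not> on p N"
  obtains r where "r \<in> A" "on r N" "r \<sim> twin p" "r \<noteq> q"
proof -
  have p': "twin p \<in> points S" using twin p by blast
  obtain r where r: "on r N" "twin p \<sim> r" using proj_ex[OF p' on_line[OF N(1)]] .
  have "r \<noteq> q"
  proof
    assume "r = q"
    then have "q \<sim> twin p" using r col_sym by blast
    then show False using col_twin_False[OF q p] pq col_sym by blast
  qed
  moreover have "r \<in> A"
  proof (rule ccontr)
    assume "r \<notin> A"
    then have "r \<in> ovoid (twin p)" using r on_point by auto
    then have "p \<sim> r" using twin(3)[OF p] by simp
    then have "on p N" using no_triangle[OF \<open>r \<noteq> q\<close> r(1) N(1) _ pq] by blast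
    then show False using N by simp
  qed
  ultimately show ?thesis using that r col_sym by blast
qed

section \<open>Common neighbours outside the subquadrangle\<close>

definition common :: "'p \<Rightarrow> 'p \<Rightarrow> 'p set" where
  "common x y = perp x \<inter> perp y \<inter> A"

lemma mem_common [simp]: "z \<in> common x y \<longleftrightarrow> z \<sim> x \<and> z \<sim> y \<and> z \<in> A"
  by (auto simp: common_def)

lemma finite_common: "finite (common x y)"
  by (simp add: common_def)

lemma inj_on_twin: "inj_on twin A"
  by (rule inj_on_inverseI[of _ twin]) simp

lemma common_not_col:
  assumes "\<not> x \<sim> y" "z \<in> common x y" "w \<in> common x y" "z \<noteq> w"
  shows "\<not> z \<sim> w"
  using perp_pair_not_col[OF assms(1), of z w] assms by simp

text \<open>These are the centers of the triad \<open>x\<close>, \<open>y\<close>,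
  \<open>twin z\<close>. A center in \<open>S'\<close> would be collinear with \<open>z\<close> as
  well, but distinct common neighbours of \<open>x\<close> and \<open>y\<close> are not
  collinear.\<close>

lemma card_common_twin:
  assumes x: "x \<in> A" and y: "y \<in> A" and nc: "\<not> x \<sim> y" and z: "z \<in> common x y"
  shows "card {w \<in> common x y. z \<sim> twin w} = s + 1"
proof -
  have zA: "z \<in> A" and z': "twin z \<in> A" using z twin by auto
  have "\<not> twin z \<sim> x" if "z \<sim> x" "x \<in> A" for x
    using col_twin_False[OF that(2) zA] that col_sym by blast
  then have "card (perp x \<inter> perp y \<inter> perp (twin z)) = s + 1"
    using x y nc z z' by (intro card_triad_centers[OF refl]) simp_all
  moreover have "perp x \<inter> perp y \<inter> perp (twin z) = {w \<in> common x y. z \<sim> twin w}"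
  proof (intro equalityI subsetI)
    fix w assume w: "w \<in> perp x \<inter> perp y \<inter> perp (twin z)"
    have "w \<in> A"
    proof (rule ccontr)
      assume "w \<notin> A"
      then have "w \<in> points S'" using w col_point by auto
      then have "w \<in> ovoid (twin z)" using w col_sym by simp
      then have "w \<in> ovoid z" using twin(3)[OF zA] by simp
      then have "z \<sim> w" "w \<noteq> z" using zA by auto
      then show False using perp_pair_not_col[OF nc, of z w] z w by simp
    qed
    then show "w \<in> {w \<in> common x y. z \<sim> twin w}"
      using w twin_col_swap[OF zA, of w] col_sym by auto
  next
    fix w assume "w \<in> {w \<in> common x y. z \<sim> twin w}"
    then show "w \<in> perp x \<inter> perp y \<inter> perp (twin z)"
      using twin_col_swap[OF zA, of w] col_sym by auto
  qed
  ultimately show ?thesis by simp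
qed

lemma joins_twin:
  assumes "x \<in> A" "y \<in> A"
  shows "joins (twin x) (twin y) = joins x y"
proof -
  have tt: "twin x \<in> A" "twin y \<in> A" using assms twin by auto
  have iff: "twin x \<sim> twin y \<longleftrightarrow> x \<sim> y"
    using twin_col[OF assms] twin_col[OF tt] assms by auto
  consider "x = y" | "x \<noteq> y" "x \<sim> y" | "\<not> x \<sim> y" by blast
  then show ?thesis
  proof cases
    case 1
    then show ?thesis using joins_self assms tt by simp
  next
    case 2
    then have "twin x \<noteq> twin y" using inj_on_twin assms by (auto dest: inj_onD)
    then show ?thesis using 2 iff joins_col by simp
  next
    case 3
    then show ?thesis using iff joins_not_col by simp
  qed
qed

text \<open>The points of \<open>common x y\<close> and their twins induce a subgraph of valency \<open>s + 1\<close>, more than the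
  second largest eigenvalue \<open>s - 1\<close> of the collinearity graph, so that it is connected.\<close>

theorem common_connected:
  assumes x: "x \<in> A" and y: "y \<in> A" and nc: "\<not> x \<sim> y"
    and Y: "Y \<subseteq> common x y" "Y \<noteq> {}"
    and closed: "\<And>z w. z \<in> Y \<Longrightarrow> w \<in> common x y \<Longrightarrow> z \<sim> twin w \<Longrightarrow> w \<in> Y"
  shows "Y = common x y"
proof (rule ccontr)
  assume "Y \<noteq> common x y"
  define Z where "Z = common x y - Y"
  have Z: "Z \<subseteq> common x y" "Z \<noteq> {}" using \<open>Y \<noteq> common x y\<close> Y by (auto simp: Z_def)
  have closedZ: "w \<in> Z" if "z \<in> Z" "w \<in> common x y" "z \<sim> twin w" for z w
  proof (rule ccontr)
    assume "w \<notin> Z"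
    moreover have "w \<sim> twin z" using that Z twin_col_swap[of z w] col_sym by fastforce
    ultimately have "z \<in> Y" using closed[of w z] that Z by (auto simp: Z_def)
    then show False using that by (simp add: Z_def)
  qed
  \<comment> \<open>Twins are added because the edges to be used run from \<open>z\<close> to
    \<open>twin w\<close>; within \<open>common x y\<close> there are none.\<close>
  define D where "D B = B \<union> twin ` B" for B
  have fin: "finite B" if "B \<subseteq> common x y" for B
    using finite_subset[OF that finite_common] .
  have sub: "D B \<subseteq> A" if "B \<subseteq> common x y" for B
    using that twin by (fastforce simp: D_def)
  have disj: "B \<inter> twin ` C = {}" if "B \<subseteq> common x y" "C \<subseteq> common x y" for B C
  proof (rule ccontr)
    assume "B \<inter> twin ` C \<noteq> {}"
    then obtain c where "c \<in> C" "twin c \<in> B" by blast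
    then have "x \<sim> c" "x \<sim> twin c" "c \<in> A" using that col_sym by auto
    then show False using col_twin_False[OF x] by blast
  qed
  have DD: "D Y \<inter> D Z = {}"
  proof -
    have "Y \<subseteq> A" "Z \<subseteq> A" "Y \<inter> Z = {}" using Y(1) Z(1) by (auto simp: Z_def)
    then have "twin ` Y \<inter> twin ` Z = {}"
      using inj_on_image_Int[OF inj_on_twin, of Y Z] by simp
    then show ?thesis using disj[of Y Z] disj[of Z Y] Y(1) Z(1) by (auto simp: D_def Z_def)
  qed
  \<comment> \<open>The diagonal entry t + 1 = s^2 + 1 plus the valency s + 1; this exceeds s + t by
    2.\<close>
  define K where "K = (real s)\<^sup>2 + 1 + (real s + 1)"
  have deg0: "(\<Sum>u\<in>D B. joins z u) = K"
    if B: "B \<subseteq> common x y" and cl: "\<forall>z\<in>B. \<forall>w\<in>common x y. z \<sim> twin w \<longrightarrow> w \<in> B"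
      and z: "z \<in> B" for B z
  proof -
    have "(\<Sum>u\<in>D B. joins z u) = (\<Sum>u\<in>B. joins z u) + (\<Sum>u\<in>twin ` B. joins z u)"
      unfolding D_def using fin[OF B] disj[OF B B] by (intro sum.union_disjoint) auto
    also have "(\<Sum>u\<in>B. joins z u) = joins z z + (\<Sum>u\<in>B - {z}. joins z u)"
      using z fin[OF B] by (intro sum.remove)
    also have "(\<Sum>u\<in>B - {z}. joins z u) = (\<Sum>u\<in>B - {z}. 0)"
      using common_not_col[OF nc] B z by (intro sum.cong refl joins_not_col) blast
    also have "joins z z = (real s)\<^sup>2 + 1" using z B joins_self[of z] by auto
    also have "(\<Sum>u\<in>twin ` B. joins z u) = (\<Sum>w\<in>B. joins z (twin w))"
      using B by (subst sum.reindex) (auto intro!: inj_on_subset[OF inj_on_twin])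
    also have "\<dots> = (\<Sum>w\<in>B. if w \<in> {w. z \<sim> twin w} then 1 else 0)"
    proof (rule sum.cong[OF refl])
      fix w assume "w \<in> B"
      then show "joins z (twin w) = (if w \<in> {w. z \<sim> twin w} then 1 else 0)"
        using joins_col[of z "twin w"] joins_not_col[of z "twin w"] disj[OF B B] z by auto
    qed
    also have "\<dots> = real (card (B \<inter> {w. z \<sim> twin w}))"
      using fin[OF B] by (subst sum.inter_restrict[symmetric]) auto
    also have "B \<inter> {w. z \<sim> twin w} = {w \<in> common x y. z \<sim> twin w}" using B cl z by blast
    finally show ?thesis using card_common_twin[OF x y nc, of z] z B by (auto simp: K_def)
  qed
  have twD: "twin ` D B = D B" if B: "B \<subseteq> common x y" for B
  proof -
    have "twin ` twin ` B = B" using B by (force simp: image_image)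
    then show ?thesis by (auto simp: D_def image_Un)
  qed
  have deg: "(\<Sum>u\<in>D B. joins w u) = K"
    if B: "B \<subseteq> common x y" and cl: "\<forall>z\<in>B. \<forall>w\<in>common x y. z \<sim> twin w \<longrightarrow> w \<in> B"
      and w: "w \<in> D B" for B w
  proof (cases "w \<in> B")
    case True
    then show ?thesis using deg0[OF B cl True] by simp
  next
    case False
    then obtain z where z: "z \<in> B" "w = twin z" using w by (auto simp: D_def)
    have "(\<Sum>u\<in>twin ` D B. joins w u) = (\<Sum>u\<in>D B. joins w (twin u))"
      using inj_on_subset[OF inj_on_twin sub[OF B]] by (subst sum.reindex) auto
    also have "\<dots> = (\<Sum>u\<in>D B. joins z u)"
      using sub[OF B] B z by (intro sum.cong refl) (auto intro!: joins_twin)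
    finally show ?thesis using twD[OF B] deg0[OF B cl z(1)] by simp
  qed
  have cross: "joins w u = 0" if wu: "w \<in> D Y" "u \<in> D Z" for w u
  proof -
    have no: "\<not> z \<sim> v \<and> \<not> z \<sim> twin v" if "z \<in> Y" "v \<in> Z" for z v
    proof -
      have "z \<in> common x y" "v \<in> common x y" "v \<notin> Y" using that Y Z by (auto simp: Z_def)
      then show ?thesis using common_not_col[OF nc, of z v] closed[of z v] that by metis
    qed
    have "\<not> w \<sim> u"
    proof
      assume col: "w \<sim> u"
      have A: "w \<in> A" "u \<in> A" using wu sub[OF Y(1)] sub[OF Z(1)] by auto
      then have tw: "twin w \<sim> twin u" using twin_col col by blast
      obtain z v where zv: "z \<in> Y" "v \<in> Z" "w = z \<or> w = twin z" "u = v \<or> u = twin v"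
        using wu unfolding D_def by blast
      then have "z \<in> A" "v \<in> A" using Y Z by auto
      then show False using no[OF zv(1,2)] zv(3,4) col tw twin_twin by metis
    qed
    then show ?thesis by (rule joins_not_col)
  qed
  \<comment> \<open>The opposite weights give \<open>f\<close> sum zero. It need not be an
    eigenfunction on all of \<open>S\<close>: the quadratic form sees \<open>smear f\<close> only on
    the support of \<open>f\<close>.\<close>
  define n m where "n = real (card (D Y))" and "m = real (card (D Z))"
  define f where "f w = (if w \<in> D Y then m else if w \<in> D Z then - n else 0)" for w
  have finD: "finite (D Y)" "finite (D Z)" using fin Y Z by (auto simp: D_def)
  have split: "(\<Sum>w\<in>points S. h w * f w) = m * sum h (D Y) - n * sum h (D Z)" for h :: "'p \<Rightarrow> real"
  proof -
    have "(\<Sum>w\<in>points S. h w * f w) = (\<Sum>w\<in>D Y \<union> D Z. h w * f w)"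
      using sub[OF Y(1)] sub[OF Z(1)]
      by (intro sum.mono_neutral_right finite_points) (auto simp: f_def)
    also have "\<dots> = (\<Sum>w\<in>D Y. h w * f w) + (\<Sum>w\<in>D Z. h w * f w)"
      using finD DD by (intro sum.union_disjoint) auto
    also have "(\<Sum>w\<in>D Y. h w * f w) = m * sum h (D Y)"
      by (simp add: f_def sum_distrib_left mult.commute)
    also have "(\<Sum>w\<in>D Z. h w * f w) = (\<Sum>w\<in>D Z. - n * h w)"
      using DD by (intro sum.cong refl) (auto simp: f_def)
    also have "\<dots> = - n * sum h (D Z)" by (simp only: sum_distrib_left)
    finally show ?thesis by simp
  qed
  have f0: "(\<Sum>w\<in>points S. f w) = 0" using split[of "\<lambda>_. 1"] by (simp add: n_def m_def)
  have sm: "smear f w = m * (\<Sum>u\<in>D Y. joins w u) - n * (\<Sum>u\<in>D Z. joins w u)" for w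
    unfolding smear_def by (rule split)
  have eig: "f w * smear f w = K * (f w)\<^sup>2" for w
  proof -
    consider "w \<in> D Y" | "w \<in> D Z" | "f w = 0" unfolding f_def by metis
    then show ?thesis
    proof cases
      case 1
      then have "smear f w = m * K" using sm deg[OF Y(1) _ 1] closed cross[OF 1] by simp
      then show ?thesis using 1 by (simp add: f_def power2_eq_square)
    next
      case 2
      then have "(\<Sum>u\<in>D Y. joins w u) = 0" using cross joins_sym by (simp add: sum.neutral)
      then have "smear f w = - n * K" using sm deg[OF Z(1) _ 2] closedZ by simp
      then show ?thesis using 2 DD by (auto simp: f_def power2_eq_square)
    next
      case 3
      then show ?thesis by simp
    qed
  qed
  define q where "q = (\<Sum>w\<in>points S. (f w)\<^sup>2)"
  have "K * q \<le> (real s + (real s)\<^sup>2) * q"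
    using smear_quadratic_bound[OF f0] by (simp add: q_def eig sum_distrib_left)
  then have "q * 2 \<le> 0" by (simp add: K_def algebra_simps)
  moreover have "q \<ge> 0" unfolding q_def by (intro sum_nonneg) auto
  ultimately have "q = 0" by simp
  then have "\<forall>w\<in>points S. (f w)\<^sup>2 = 0" unfolding q_def
    using finite_points by (subst (asm) sum_nonneg_eq_0_iff) auto
  moreover obtain w where w: "w \<in> Y" using Y by blast
  moreover have "w \<in> points S" using w Y by auto
  ultimately have "m = 0" using w by (auto simp: f_def D_def)
  then show False using finD Z by (auto simp: m_def D_def)
qed

section \<open>Rosettes, and the number of common neighbours\<close>

lemma rosette_eq: "rosette S S' N = ovoid ` {y \<in> A. on y N}"
  using on_point by (auto simp: rosette_def)

lemma rosetteE:
  assumes "O' \<in> rosette S S' N" obtains p where "p \<in> A" "on p N" "ovoid p = O'"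
  using assms unfolding rosette_eq by blast

lemma rosetteI: "p \<in> A \<Longrightarrow> on p N \<Longrightarrow> ovoid p \<in> rosette S S' N"
  unfolding rosette_eq by blast

lemma rosette_twin_subset:
  assumes "p \<in> A" "q \<in> A" "p \<noteq> q" "on p M" "on q M" "on (twin p) N" "on (twin q) N"
  shows "rosette S S' M \<subseteq> rosette S S' N"
proof -
  have tw: "twin p \<noteq> twin q" using inj_on_twin assms by (auto dest: inj_onD)
  have "ovoid y \<in> ovoid ` {y \<in> A. on y N}" if y: "y \<in> A" "on y M" for y
  proof -
    have "twin y \<sim> twin p" "twin y \<sim> twin q" using twin_col y assms colI by blast+
    then have "on (twin y) N" using no_triangle[OF tw assms(6,7)] by blast
    then show ?thesis using twin[OF y(1)] by (metis (mono_tags, lifting) image_eqI mem_Collect_eq)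
  qed
  then show ?thesis unfolding rosette_eq by blast
qed

text \<open>\<E> is a partial linear space: the representatives of the two ovoids on
  \<open>N\<close> are \<open>p\<close>, \<open>q\<close> or their twins, the mixed choices being
  excluded by \<open>col_twin_False\<close>.\<close>

lemma rosette_unique:
  assumes p: "p \<in> A" "on p M" and q: "q \<in> A" "on q M" and pq: "p \<noteq> q"
    and R: "ovoid p \<in> rosette S S' N" "ovoid q \<in> rosette S S' N"
  shows "rosette S S' M = rosette S S' N"
proof -
  obtain p' q' where p': "p' \<in> A" "on p' N" "ovoid p' = ovoid p"
    and q': "q' \<in> A" "on q' N" "ovoid q' = ovoid q"
    using rosetteE[OF R(1)] rosetteE[OF R(2)] by metis
  have col: "p \<sim> q" "p' \<sim> q'" using p q p' q' colI by blast+
  consider "p' = p" "q' = q" | "p' = twin p" "q' = twin q" | "p' = p" "q' = twin q" | "p' = twin p" "q' = q"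
    using twin_unique p(1) q(1) p' q' by metis
  then show ?thesis
  proof cases
    case 1
    then show ?thesis using line_eq p q p' q' pq by metis
  next
    case 2
    have "twin p \<noteq> twin q" using pq inj_on_twin p q by (auto dest: inj_onD)
    then show ?thesis
      using rosette_twin_subset[of p q M N] rosette_twin_subset[of "twin p" "twin q" N M] p q p' q' pq 2
      by auto
  next
    case 3
    then show ?thesis using col_twin_False[OF p(1) q(1)] col by blast
  next
    case 4
    then show ?thesis using col_twin_False[OF q(1) p(1)] col col_sym by blast
  qed
qed

lemma ex_A_point:
  assumes N: "N \<in> lines S - lines S'"
  obtains y where "y \<in> A" "on y N" "y \<noteq> x"
proof -
  obtain a where a: "a \<in> A" "on a N" using N by (rule line_A)
  have "\<not> points_on S N \<subseteq> {base N, x}"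
    using card_points_on[of N] N s_gt_1 card_mono[of "{base N, x}" "points_on S N"]
      card_insert_le_m1[of 2 "{x}" "base N"] by auto
  then obtain y where "y \<in> points_on S N" "y \<notin> {base N, x}" by blast
  then have "on y N" "y \<noteq> base N" "y \<noteq> x" by simp_all
  moreover then have "y \<in> A" using base_unique[OF a] on_point by blast
  ultimately show ?thesis using that by blast
qed

lemma card_common:
  assumes x: "x \<in> A" and y: "y \<in> A" and nc: "\<not> x \<sim> y"
  shows "card (common x y) = s\<^sup>2 + 1 - card (ovoid x \<inter> ovoid y)"
proof -
  have "common x y = perp x \<inter> perp y - ovoid x \<inter> ovoid y"
    using col_point col_sym by (auto simp: common_def)
  moreover have "ovoid x \<inter> ovoid y \<subseteq> perp x \<inter> perp y" using col_sym by auto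
  moreover have "card (perp x \<inter> perp y) = s\<^sup>2 + 1" using card_common_perp x y nc by simp
  ultimately show ?thesis using finite_ovoid by (simp add: card_Diff_subset)
qed

lemma common_sym: "common x y = common y x"
  by (auto simp: common_def)

lemma card_common_far:
  assumes x: "x \<in> A" and y: "y \<in> A" and nc: "\<not> x \<sim> y" "\<not> x \<sim> twin y"
  shows "card (common x y) = s\<^sup>2 - s"
proof -
  have "card (ovoid x \<inter> ovoid y) = s + 1"
    using x y nc twin_col_swap[OF x y] col_sym by (intro card_ovoid_Int) blast+
  then show ?thesis using card_common[OF x y nc(1)] by simp
qed

lemma common_far_nonempty:
  assumes "x \<in> A" "y \<in> A" "\<not> x \<sim> y" "\<not> x \<sim> twin y"
  obtains z where "z \<in> common x y"
proof -
  have "s * 1 < s * s" using s_gt_1 by (intro mult_strict_left_mono) auto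
  then have "card (common x y) > 0" using card_common_far[OF assms] by (simp add: power2_eq_square)
  then show ?thesis using that by (metis card.empty ex_in_conv less_irrefl)
qed

text \<open>For s = 2 there would be s^2 - s = 2 common neighbours, too few for the s + 1 = 3 of
  \<open>card_common_twin\<close>.\<close>

lemma far_imp_s_gt_2:
  assumes x: "x \<in> A" and y: "y \<in> A" and nc: "\<not> x \<sim> y" "\<not> x \<sim> twin y"
  shows "s > 2"
proof (rule ccontr)
  assume "\<not> s > 2"
  then have s: "s = 2" using s_gt_1 by simp
  obtain z where z: "z \<in> common x y" using common_far_nonempty[OF assms] .
  have "card {w \<in> common x y. z \<sim> twin w} \<le> card (common x y)"
    by (intro card_mono finite_common) auto
  then show False using card_common_twin[OF x y nc(1) z] card_common_far[OF assms] s by simp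
qed

text \<open>In the next lemma each line through \<open>y\<close> contributes at most one point, since \<open>z\<close> is not on it, and
  the line \<open>y u\<close> contributes none.\<close>

lemma card_common_base:
  assumes x: "x \<in> A" and y: "y \<in> A" and z: "z \<in> A"
    and yx: "\<not> x \<sim> y" "\<not> x \<sim> twin y" and yz: "\<not> y \<sim> z"
    and u: "u \<in> ovoid x" "u \<in> ovoid y" "u \<in> ovoid z"
  shows "card {m \<in> common y z. \<exists>N. on y N \<and> on m N \<and> base N \<in> ovoid x} \<le> s" (is "card ?B \<le> s")
proof -
  define k where "k v = (THE m. m \<in> common y z \<and> (\<exists>N. on y N \<and> on m N \<and> on v N))" for v
  have "?B \<subseteq> k ` (ovoid x \<inter> ovoid y - {u})"
  proof
    fix m assume "m \<in> ?B"
    then obtain N where m: "m \<in> common y z" and N: "on y N" "on m N" "base N \<in> ovoid x" by blast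
    have b: "base N \<in> points S'" "on (base N) N" using base[OF y N(1)] .
    have zN: "\<not> on z N" using yz N(1) colI by blast
    have zm: "z \<sim> m" using m col_sym by auto
    \<comment> \<open>On the line through \<open>u\<close> the projection of \<open>z\<close> is
      \<open>u\<close> itself, which is not in \<open>A\<close>.\<close>
    have "base N \<noteq> u"
    proof
      assume "base N = u"
      then have "m = base N" using proj_unique[OF zN N(2) b(2) zm] u(3) by simp
      then show False using m b by simp
    qed
    moreover have "base N \<in> ovoid y" using b N colI by auto
    moreover have "k (base N) = m"
      unfolding k_def
    proof (rule the_equality)
      show "m \<in> common y z \<and> (\<exists>Na. on y Na \<and> on m Na \<and> on (base N) Na)" using m N b by blast
      fix m' assume "m' \<in> common y z \<and> (\<exists>Na. on y Na \<and> on m' Na \<and> on (base N) Na)"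
      then obtain M where m': "m' \<in> common y z" and M: "on y M" "on m' M" "on (base N) M" by blast
      have "M = N" using line_eq[OF M(1,3) N(1) b(2)] y b(1) by auto
      moreover have "z \<sim> m'" using m' col_sym by auto
      ultimately show "m' = m" using proj_unique[OF zN _ N(2) _ zm] M by blast
    qed
    ultimately show "m \<in> k ` (ovoid x \<inter> ovoid y - {u})" using N(3) by blast
  qed
  then have "card ?B \<le> card (k ` (ovoid x \<inter> ovoid y - {u}))"
    by (intro card_mono) (auto simp: finite_ovoid)
  also have "\<dots> \<le> card (ovoid x \<inter> ovoid y - {u})" by (intro card_image_le) (auto simp: finite_ovoid)
  also have "card (ovoid x \<inter> ovoid y) = s + 1"
    using x y yx twin_col_swap[OF x y] col_sym by (intro card_ovoid_Int) blast+
  then have "card (ovoid x \<inter> ovoid y - {u}) = s"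
    using u by (simp add: card_Diff_singleton)
  finally show ?thesis .
qed

section \<open>Extending automorphisms of the complement\<close>

definition trace :: "'p \<Rightarrow> 'p set" where
  "trace u = perp u \<inter> A"

lemma mem_trace [simp]: "x \<in> trace u \<longleftrightarrow> x \<sim> u \<and> x \<in> A"
  by (auto simp: trace_def)

lemma finite_trace: "finite (trace u)"
  by (simp add: trace_def)

lemma sub_perp:
  assumes "u \<in> points S'"
  shows "sub.perp u = perp u \<inter> points S'"
proof (intro equalityI subsetI)
  fix v assume "v \<in> sub.perp u"
  then have v: "collinear S' v u" by simp
  then obtain N where "sub.on v N" "sub.on u N" by (rule sub.colE)
  then show "v \<in> perp u \<inter> points S'" using sub_inc colI by auto
next
  fix v assume v: "v \<in> perp u \<inter> points S'"
  then show "v \<in> sub.perp u"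
    using sub_colE[of v u] sub.col_refl[OF assms] assms by (cases "v = u") auto
qed

text \<open>The size does not depend on \<open>u\<close>, so an inclusion between traces is an
  equality.\<close>

lemma card_trace:
  assumes u: "u \<in> points S'"
  shows "real (card (trace u)) = real s * real s * (real s - 1)"
proof -
  have "trace u = perp u - sub.perp u" using sub_perp[OF u] col_point by auto
  moreover have "sub.perp u \<subseteq> perp u" using sub_perp[OF u] by blast
  moreover have "real (card (perp u)) = 1 + real s * (real s * real s + 1)"
    using card_perp[of u] u sub_points by (auto simp: power2_eq_square)
  moreover have "real (card (sub.perp u)) = 1 + real s * (real s + 1)"
    using sub.card_perp[OF u] by simp
  ultimately show ?thesis
    using card_mono[of "perp u" "sub.perp u"]
    by (simp add: card_Diff_subset of_nat_diff algebra_simps)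
qed

lemma trace_line:
  assumes u: "u \<in> points S'" and x: "x \<in> trace u" and M: "on x M" "on u M"
  obtains y where "y \<in> trace u" "y \<noteq> x" "on y M"
proof -
  obtain y where "y \<in> A" "on y M" "y \<noteq> x" using ex_A_point[OF A_line[OF _ M(1)]] x by auto
  then show ?thesis using that M colI by auto
qed

text \<open>A line from \<open>u\<close> into \<open>A\<close> carries two points of the trace;
  \<open>u'\<close> is collinear with both, hence on that line, which has only one point in
  \<open>S'\<close>.\<close>

lemma trace_inject:
  assumes u: "u \<in> points S'" "u' \<in> points S'" and eq: "trace u = trace u'"
  shows "u = u'"
proof -
  have "real (card (trace u)) > 0" using card_trace[OF u(1)] s_gt_1 by simp
  then obtain x where x: "x \<in> trace u" by (metis card.empty ex_in_conv less_irrefl of_nat_0)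
  then have "x \<sim> u" by simp
  then obtain M where M: "on x M" "on u M" by (rule colE)
  obtain y where y: "y \<in> trace u" "y \<noteq> x" "on y M" using trace_line[OF u(1) x M] .
  have "u' \<sim> x" "u' \<sim> y" using x y eq col_sym mem_trace by blast+
  then have "on u' M" using no_triangle[OF y(2)[symmetric] M(1) y(3)] by blast
  moreover have "x \<in> A" using x by simp
  ultimately show ?thesis using base_unique M u by metis
qed

text \<open>Non-collinear points of \<open>S'\<close> have s^2 + 1 common neighbours in
  \<open>S\<close> but only s + 1 in \<open>S'\<close>, so some lie in \<open>A\<close>. For
  collinear points a common neighbour lies on their line, inside \<open>S'\<close>.\<close>

lemma sub_col_iff_trace:
  assumes u: "u \<in> points S'" "v \<in> points S'" and uv: "u \<noteq> v"
  shows "u \<sim> v \<longleftrightarrow> trace u \<inter> trace v = {}"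
proof
  assume "u \<sim> v"
  then obtain N where N: "on u N" "on v N" by (rule colE)
  then have N': "N \<in> lines S'" using sub_lineI[OF uv u] by blast
  have "x \<in> points S'" if "x \<sim> u" "x \<sim> v" for x
    using sub_line_points[OF N'] no_triangle[OF uv N that] by blast
  then show "trace u \<inter> trace v = {}" by auto
next
  assume tr: "trace u \<inter> trace v = {}"
  show "u \<sim> v"
  proof (rule ccontr)
    assume nc: "\<not> u \<sim> v"
    have "\<not> collinear S' u v" using nc sub_inc sub.colE colI by metis
    then have "card (sub.perp u \<inter> sub.perp v) = s + 1" using sub.card_common_perp u by blast
    moreover have "card (perp u \<inter> perp v) = s\<^sup>2 + 1" using card_common_perp nc u sub_points by blast
    moreover have "sub.perp u \<inter> sub.perp v = perp u \<inter> perp v"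
      using tr sub_perp u col_point by (auto simp: trace_def)
    ultimately have "s * s = s * 1" by (simp add: power2_eq_square)
    then show False using s_gt_1 by (subst (asm) mult_left_cancel) auto
  qed
qed

text \<open>The points of the subquadrangle are parallel classes of lines of the complement: two distinct lines of the
  complement meet in \<open>S'\<close> precisely when no line of the complement meets both.\<close>

lemma trace_image:
  assumes \<alpha>: "bij_betw \<alpha> A A"
    and col: "\<And>x y. x \<in> A \<Longrightarrow> y \<in> A \<Longrightarrow> \<alpha> x \<sim> \<alpha> y \<longleftrightarrow> x \<sim> y"
    and u: "u \<in> points S'"
  obtains v where "v \<in> points S'" "\<alpha> ` trace u = trace v"
proof -
  have \<alpha>A: "\<alpha> x \<in> A" if "x \<in> A" for x using \<alpha> that bij_betwE by blast
  have inj: "inj_on \<alpha> A" using \<alpha> bij_betw_imp_inj_on by blast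
  have lines: "\<exists>K. on (\<alpha> x) K \<and> on (\<alpha> y) K \<and> (\<forall>z\<in>A. on z M \<longleftrightarrow> on (\<alpha> z) K)"
    if xy: "x \<in> A" "y \<in> A" "x \<noteq> y" and M: "on x M" "on y M" for x y M
  proof -
    have "\<alpha> x \<sim> \<alpha> y" using col xy M colI by blast
    then obtain K where K: "on (\<alpha> x) K" "on (\<alpha> y) K" by (rule colE)
    have ne: "\<alpha> x \<noteq> \<alpha> y" using inj xy by (auto dest: inj_onD)
    have "on z M \<longleftrightarrow> z \<sim> x \<and> z \<sim> y" for z using no_triangle[OF xy(3) M] M colI by blast
    moreover have "on z K \<longleftrightarrow> z \<sim> \<alpha> x \<and> z \<sim> \<alpha> y" for z using no_triangle[OF ne K] K colI by blast
    ultimately show ?thesis using K col xy by blast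
  qed
  have "real (card (trace u)) > 0" using card_trace[OF u] s_gt_1 by simp
  then obtain x where x: "x \<in> trace u" by (metis card.empty ex_in_conv less_irrefl of_nat_0)
  then have xA: "x \<in> A" "x \<sim> u" by auto
  obtain M where M: "on x M" "on u M" using xA(2) by (rule colE)
  obtain y where y: "y \<in> trace u" "y \<noteq> x" "on y M" using trace_line[OF u x M] .
  have yA: "y \<in> A" using y by simp
  obtain K where K: "on (\<alpha> x) K" "on (\<alpha> y) K" "\<forall>z\<in>A. on z M \<longleftrightarrow> on (\<alpha> z) K"
    using lines[OF xA(1) yA y(2)[symmetric] M(1) y(3)] by blast
  define v where "v = base K"
  have v: "v \<in> points S'" "on v K" using base[OF \<alpha>A[OF xA(1)] K(1)] by (simp_all add: v_def)
  have "\<alpha> w \<sim> v" if w: "w \<in> trace u" for w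
  proof (cases "on w M")
    case True
    then show ?thesis using K(3) w v colI by auto
  next
    case False
    have wA: "w \<in> A" "w \<sim> u" using w by auto
    obtain M' where M': "on w M'" "on u M'" using wA(2) by (rule colE)
    obtain w' where w': "w' \<in> trace u" "w' \<noteq> w" "on w' M'" using trace_line[OF u w M'] .
    obtain K' where K': "on (\<alpha> w) K'" "on (\<alpha> w') K'" "\<forall>z\<in>A. on z M' \<longleftrightarrow> on (\<alpha> z) K'"
      using lines[OF wA(1) _ w'(2)[symmetric] M'(1) w'(3)] w' by auto
    show ?thesis
    proof (rule ccontr)
      assume "\<not> \<alpha> w \<sim> v"
      then have vK': "\<not> on v K'" using K' colI by blast
      \<comment> \<open>If \<open>\<alpha> a\<close> projected into \<open>A\<close> on
        \<open>K'\<close>, pulling back would give a triangle \<open>a\<close>, \<open>u\<close>,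
        \<open>c\<close> and force \<open>M\<close> = \<open>M'\<close>. So it projects to the base
        of \<open>K'\<close>. Applied to \<open>x\<close> and \<open>y\<close>, this puts that base
        on \<open>K\<close>, so it is \<open>v\<close>, which was assumed to be off
        \<open>K'\<close>.\<close>
      have to_base: "\<alpha> a \<sim> base K'" if a: "a \<in> trace u" "on a M" for a
      proof -
        have aA: "a \<in> A" "a \<sim> u" using a by auto
        obtain b where b: "on b K'" "\<alpha> a \<sim> b"
          using proj_ex[of "\<alpha> a" K'] \<alpha>A[OF aA(1)] on_line[OF K'(1)] by blast
        have "b \<notin> A"
        proof
          assume "b \<in> A"
          then obtain c where c: "c \<in> A" "\<alpha> c = b" using \<alpha> by (metis bij_betw_iff_bijections)
          have cM': "on c M'" using K'(3) c b by blast
          have "a \<sim> c" using col aA c b by blast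
          moreover have "u \<noteq> c" using c u by auto
          ultimately have "on a M'" using no_triangle[OF _ M'(2) cM', of a] aA by blast
          moreover have "a \<noteq> u" using aA u by auto
          ultimately have "M = M'" using line_eq[OF a(2) M(2)] M'(2) by blast
          then show False using False M' by blast
        qed
        then have "b \<in> points S'" using b on_point by blast
        then have "b = base K'" using base_unique[OF \<alpha>A[OF wA(1)] K'(1)] b(1) by blast
        then show ?thesis using b by blast
      qed
      have ne: "\<alpha> x \<noteq> \<alpha> y" using inj xA yA y by (auto dest: inj_onD)
      have "on (base K') K"
        using no_triangle[OF ne K(1,2)] to_base[OF x M(1)] to_base[OF y(1,3)] col_sym by blast
      then have "base K' = v"
        using base_unique[OF \<alpha>A[OF xA(1)] K(1)] base[OF \<alpha>A[OF wA(1)] K'(1)] v_def by blast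
      then show False using vK' base[OF \<alpha>A[OF wA(1)] K'(1)] by blast
    qed
  qed
  then have "\<alpha> ` trace u \<subseteq> trace v" using \<alpha>A by auto
  moreover have "card (\<alpha> ` trace u) = card (trace v)"
  proof -
    have "card (\<alpha> ` trace u) = card (trace u)"
      by (rule card_image, rule inj_on_subset[OF inj]) auto
    then show ?thesis using card_trace[OF u] card_trace[OF v(1)] by (metis of_nat_eq_iff)
  qed
  ultimately have "\<alpha> ` trace u = trace v" by (intro card_subset_eq finite_trace)
  then show ?thesis using that v by blast
qed

theorem extend_to_automorphism:
  assumes \<alpha>A: "\<And>x. x \<in> A \<Longrightarrow> \<alpha> x \<in> A" and inj: "inj_on \<alpha> A"
    and col: "\<And>x y. x \<in> A \<Longrightarrow> y \<in> A \<Longrightarrow> x \<sim> y \<Longrightarrow> \<alpha> x \<sim> \<alpha> y"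
  obtains f g where "automorphism S f g" "stabilizes f g S'" "\<And>x. x \<in> A \<Longrightarrow> f x = \<alpha> x"
    "\<And>N. N \<in> lines S \<Longrightarrow> points_on S (g N) = f ` points_on S N"
proof -
  have finA: "finite A" using finite_points by simp
  have surj: "\<alpha> ` A = A" using endo_inj_surj[OF finA _ inj] \<alpha>A by blast
  then have bij: "bij_betw \<alpha> A A" using inj by (simp add: bij_betw_def)
  \<comment> \<open>An injective map of the finite set of collinear pairs to itself is onto, so
    \<alpha> also reflects collinearity.\<close>
  define E where "E = {(x, y). x \<in> A \<and> y \<in> A \<and> x \<sim> y}"
  have "finite E" by (rule finite_subset[of _ "A \<times> A"]) (use finA in \<open>auto simp: E_def\<close>)
  moreover have "map_prod \<alpha> \<alpha> ` E \<subseteq> E" using \<alpha>A col by (auto simp: E_def)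
  moreover have "inj_on (map_prod \<alpha> \<alpha>) E"
    by (rule inj_on_subset[OF map_prod_inj_on[OF inj inj]]) (auto simp: E_def)
  ultimately have surjE: "map_prod \<alpha> \<alpha> ` E = E" by (rule endo_inj_surj)
  have col_iff: "\<alpha> x \<sim> \<alpha> y \<longleftrightarrow> x \<sim> y" if xy: "x \<in> A" "y \<in> A" for x y
  proof
    assume "\<alpha> x \<sim> \<alpha> y"
    then have "(\<alpha> x, \<alpha> y) \<in> map_prod \<alpha> \<alpha> ` E" unfolding surjE using \<alpha>A xy by (simp add: E_def)
    then obtain a b where ab: "a \<in> A" "b \<in> A" "a \<sim> b" "\<alpha> a = \<alpha> x" "\<alpha> b = \<alpha> y" by (auto simp: E_def)
    then have "a = x" "b = y" using inj xy by (auto dest: inj_onD)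
    then show "x \<sim> y" using ab by blast
  qed (rule col[OF xy])
  define h where "h u = (SOME v. v \<in> points S' \<and> \<alpha> ` trace u = trace v)" for u
  have h: "h u \<in> points S'" "\<alpha> ` trace u = trace (h u)" if u: "u \<in> points S'" for u
  proof -
    have "\<exists>v. v \<in> points S' \<and> \<alpha> ` trace u = trace v" using trace_image[OF bij col_iff u] by blast
    then have "h u \<in> points S' \<and> \<alpha> ` trace u = trace (h u)" unfolding h_def by (rule someI_ex)
    then show "h u \<in> points S'" "\<alpha> ` trace u = trace (h u)" by blast+
  qed
  have trA: "trace u \<subseteq> A" for u by auto
  have inj_h: "inj_on h (points S')"
  proof (rule inj_onI)
    fix u v assume uv: "u \<in> points S'" "v \<in> points S'" "h u = h v"
    then have "\<alpha> ` trace u = \<alpha> ` trace v" using h by metis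
    then have "trace u = trace v" using inj_on_image_eq_iff[OF inj trA trA] by blast
    then show "u = v" using trace_inject uv by blast
  qed
  define f where "f x = (if x \<in> A then \<alpha> x else if x \<in> points S' then h x else x)" for x
  have fA: "f x = \<alpha> x" if "x \<in> A" for x using that by (simp add: f_def)
  have fS: "f u = h u" if "u \<in> points S'" for u using that by (simp add: f_def)
  have P: "points S = A \<union> points S'" using sub_points by blast
  have "inj_on f (points S)"
  proof (rule inj_onI)
    fix x y assume xy: "x \<in> points S" "y \<in> points S" "f x = f y"
    have "x \<in> A \<longleftrightarrow> y \<in> A" using xy P fA fS \<alpha>A h(1) by (metis DiffE Un_iff)
    then show "x = y" using xy P fA fS inj inj_h by (metis Un_iff inj_onD)
  qed
  moreover have fP: "f x \<in> points S" if "x \<in> points S" for x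
  proof (cases "x \<in> A")
    case True
    then show ?thesis using fA \<alpha>A by auto
  next
    case False
    then have "x \<in> points S'" using that by simp
    then show ?thesis using fS h(1) sub_points by auto
  qed
  ultimately have "bij_betw f (points S) (points S)"
    unfolding bij_betw_def using finite_points by (simp add: endo_inj_surj image_subsetI)
  then have perm: "f permutes points S"
    by (rule bij_imp_permutes) (use P in \<open>auto simp: f_def\<close>)
  have AS: "\<alpha> x \<sim> h u \<longleftrightarrow> x \<sim> u" if xu: "x \<in> A" "u \<in> points S'" for x u
  proof -
    have "\<alpha> x \<sim> h u \<longleftrightarrow> \<alpha> x \<in> trace (h u)" using \<alpha>A[OF xu(1)] by simp
    also have "\<dots> \<longleftrightarrow> \<alpha> x \<in> \<alpha> ` trace u" using h(2)[OF xu(2)] by simp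
    also have "\<dots> \<longleftrightarrow> x \<in> trace u" using inj_on_image_mem_iff[OF inj xu(1) trA] .
    finally show ?thesis using xu by simp
  qed
  have SS: "h u \<sim> h v \<longleftrightarrow> u \<sim> v" if uv: "u \<in> points S'" "v \<in> points S'" for u v
  proof (cases "u = v")
    case True
    then show ?thesis using col_refl h(1)[OF uv(1)] uv sub_points by auto
  next
    case False
    have "h u \<noteq> h v" using False inj_h uv by (auto dest: inj_onD)
    then have "h u \<sim> h v \<longleftrightarrow> trace (h u) \<inter> trace (h v) = {}"
      using sub_col_iff_trace h(1) uv by blast
    also have "\<dots> \<longleftrightarrow> \<alpha> ` (trace u \<inter> trace v) = {}"
      using h(2) uv inj_on_image_Int[OF inj trA trA] by simp
    also have "\<dots> \<longleftrightarrow> u \<sim> v" using sub_col_iff_trace[OF uv False] by blast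
    finally show ?thesis .
  qed
  have colf: "f x \<sim> f y \<longleftrightarrow> x \<sim> y" if xy: "x \<in> points S" "y \<in> points S" for x y
  proof -
    consider "x \<in> A" "y \<in> A" | "x \<in> A" "y \<in> points S'" | "x \<in> points S'" "y \<in> A"
      | "x \<in> points S'" "y \<in> points S'" using xy P by blast
    then show ?thesis
    proof cases
      case 1
      then show ?thesis using fA col_iff by simp
    next
      case 2
      then show ?thesis using fA[OF 2(1)] fS[OF 2(2)] AS by simp
    next
      case 3
      then have "\<alpha> y \<sim> h x \<longleftrightarrow> y \<sim> x" using AS by blast
      then show ?thesis using fA[OF 3(2)] fS[OF 3(1)] col_sym by metis
    next
      case 4
      then show ?thesis using fS SS by simp
    qed
  qed
  obtain g where g: "automorphism S f g" "\<And>N. N \<in> lines S \<Longrightarrow> points_on S (g N) = f ` points_on S N"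
    using collineation_imp_automorphism[OF perm colf] by blast
  have fS': "f ` points S' = points S'"
  proof -
    have "f ` points S' = h ` points S'" using fS by simp
    also have "\<dots> = points S'" using h(1) inj_h sub.finite_points by (intro endo_inj_surj) auto
    finally show ?thesis .
  qed
  have gperm: "g permutes lines S" using g(1) by (simp add: automorphism_def)
  have "g N \<in> lines S'" if N: "N \<in> lines S'" for N
  proof -
    have NL: "N \<in> lines S" using N sub_lines by blast
    obtain x where x: "on x (g N)" using ex_other_point permutes_in_image[OF gperm] NL by metis
    obtain y where y: "on y (g N)" "y \<noteq> x" using ex_other_point permutes_in_image[OF gperm] NL by metis
    have "z \<in> points S'" if "on z (g N)" for z
    proof -
      have "z \<in> f ` points_on S N" using that g(2)[OF NL] mem_points_on by blast
      then show ?thesis using fS' sub_line_points[OF N] by auto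
    qed
    then show ?thesis using sub_lineI[of x y] x y by blast
  qed
  then have "g ` lines S' = lines S'"
    using sub.finite_lines permutes_inj_on[OF gperm] by (intro endo_inj_surj) auto
  then have "stabilizes f g S'" using fS' by (simp add: stabilizes_def)
  then show ?thesis using that g fA by blast
qed

lemma ex_A: obtains x where "x \<in> A"
proof -
  have "real (card (points S')) < real (card (points S))"
  proof -
    have "real s * real s * 1 < real s * real s * real s"
      using s_gt_1 by (intro mult_strict_left_mono) auto
    then have "(real s + 1) * (real s * real s + 1) < (real s + 1) * (real s * real (s\<^sup>2) + 1)"
      using s_gt_1 by (intro mult_strict_left_mono) (auto simp: power2_eq_square mult_ac)
    then show ?thesis using card_points sub.card_points by simp
  qed
  then have "\<not> points S \<subseteq> points S'" using card_mono[OF sub.finite_points, of "points S"] by auto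
  then show ?thesis using that by blast
qed

end

section \<open>Covers of the geometry of subtended ovoids\<close>

locale cover_of_ovoids = doubly_subtended_pair +
  fixes \<gamma>\<^sub>p :: "'a \<Rightarrow> 'a set" and \<gamma>\<^sub>l :: "'b \<Rightarrow> 'a set set"
  assumes cov: "cover (geom_A S S') (geom_E S S') \<gamma>\<^sub>p \<gamma>\<^sub>l"
begin

lemma points_on_A: "points_on (geom_A S S') N = {x \<in> A. on x N}"
  using A_line by (auto simp: points_on_def geom_A_def)

lemma lines_through_A: "x \<in> A \<Longrightarrow> lines_through (geom_A S S') x = lines_through S x"
  using A_line by (auto simp: lines_through_def geom_A_def)

lemma rosette_subset: "rosette S S' N \<subseteq> subtended_ovoids S S'"
  unfolding rosette_eq subtended_ovoids_def by blast

lemma points_on_E: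
  "N \<in> lines S - lines S' \<Longrightarrow> points_on (geom_E S S') (rosette S S' N) = rosette S S' N"
  using rosette_subset by (auto simp: points_on_def geom_E_def)

lemma cover_point: assumes "x \<in> A" obtains p where "p \<in> A" "\<gamma>\<^sub>p x = ovoid p"
proof -
  have "\<gamma>\<^sub>p x \<in> subtended_ovoids S S'"
    using cov assms by (auto simp: cover_def geom_A_def geom_E_def)
  then show ?thesis using that by (auto simp: subtended_ovoids_def)
qed

lemma cover_line:
  assumes "N \<in> lines S - lines S'" obtains K where "K \<in> lines S - lines S'" "\<gamma>\<^sub>l N = rosette S S' K"
proof -
  have "\<gamma>\<^sub>l N \<in> rosette S S' ` (lines S - lines S')"
    using cov assms by (auto simp: cover_def geom_A_def geom_E_def)
  then show ?thesis using that by blast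
qed

lemma cover_points_on:
  assumes N: "N \<in> lines S - lines S'"
  shows "bij_betw \<gamma>\<^sub>p {x \<in> A. on x N} (\<gamma>\<^sub>l N)"
proof -
  have "N \<in> lines (geom_A S S')" using N by (simp add: geom_A_def)
  then have "bij_betw \<gamma>\<^sub>p (points_on (geom_A S S') N) (points_on (geom_E S S') (\<gamma>\<^sub>l N))"
    using cov by (simp add: cover_def)
  moreover obtain K where "K \<in> lines S - lines S'" "\<gamma>\<^sub>l N = rosette S S' K"
    using N by (rule cover_line)
  ultimately show ?thesis using points_on_E points_on_A by metis
qed

lemma cover_inc: "x \<in> A \<Longrightarrow> on x N \<Longrightarrow> \<gamma>\<^sub>p x \<in> \<gamma>\<^sub>l N"
  using cover_points_on[OF A_line] by (auto simp: bij_betw_def)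

lemma cover_inj:
  "x \<in> A \<Longrightarrow> y \<in> A \<Longrightarrow> x \<sim> y \<Longrightarrow> \<gamma>\<^sub>p x = \<gamma>\<^sub>p y \<Longrightarrow> x = y"
  by (elim colE) (use cover_points_on[OF A_line] in \<open>auto simp: bij_betw_def dest: inj_onD\<close>)

lemma cover_lines_through:
  assumes x: "x \<in> A"
  shows "bij_betw \<gamma>\<^sub>l (lines_through S x) {R \<in> rosette S S' ` (lines S - lines S'). \<gamma>\<^sub>p x \<in> R}"
proof -
  have "x \<in> points (geom_A S S')" using x by (simp add: geom_A_def)
  then have "bij_betw \<gamma>\<^sub>l (lines_through (geom_A S S') x) (lines_through (geom_E S S') (\<gamma>\<^sub>p x))"
    using cov by (simp add: cover_def)
  moreover have "lines_through (geom_E S S') (\<gamma>\<^sub>p x)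
      = {R \<in> rosette S S' ` (lines S - lines S'). \<gamma>\<^sub>p x \<in> R}"
    using rosette_subset by (auto simp: lines_through_def geom_E_def)
  ultimately show ?thesis using lines_through_A[OF x] by simp
qed

section \<open>Lifting points and edges through the projection\<close>

definition lift :: "'a \<Rightarrow> 'a \<Rightarrow> bool" where
  "lift x p \<longleftrightarrow> x \<in> A \<and> p \<in> A \<and> ovoid p = \<gamma>\<^sub>p x"

lemma liftD: "lift x p \<Longrightarrow> x \<in> A" "lift x p \<Longrightarrow> p \<in> A" "lift x p \<Longrightarrow> ovoid p = \<gamma>\<^sub>p x"
  by (simp_all add: lift_def)

lemma lift_ex: assumes "x \<in> A" obtains p where "lift x p"
  using cover_point[OF assms] assms unfolding lift_def by metis

lemma lift_twin: "lift x p \<Longrightarrow> lift x (twin p)"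
  using twin by (simp add: lift_def)

lemma lift_unique: "lift x p \<Longrightarrow> lift x q \<Longrightarrow> q = p \<or> q = twin p"
  using twin_unique by (simp add: lift_def)

lemma lift_neq: "lift x p \<Longrightarrow> lift y q \<Longrightarrow> x \<sim> y \<Longrightarrow> x \<noteq> y \<Longrightarrow> p \<noteq> q"
  using cover_inj by (auto simp: lift_def)

lemma lift_line:
  assumes x: "lift x p" and y: "lift y q" and xy: "x \<noteq> y" "on x N" "on y N" and K: "on p K" "on q K"
  shows "\<gamma>\<^sub>l N = rosette S S' K"
proof -
  obtain M where M: "\<gamma>\<^sub>l N = rosette S S' M"
    using cover_line[OF A_line[OF liftD(1)[OF x] xy(2)]] by blast
  have "ovoid p \<in> rosette S S' M" "ovoid q \<in> rosette S S' M"
    using cover_inc[of x N] cover_inc[of y N] x y xy M by (simp_all add: lift_def)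
  then show ?thesis
    using rosette_unique[of p K q M] lift_neq[OF x y] x y xy K M colI by (simp add: lift_def)
qed

text \<open>The image line is a rosette of some \<open>K\<close>, on which a lift of
  \<open>x\<close> and one of \<open>y\<close> are collinear. If that lift of \<open>x\<close> is
  \<open>twin p\<close>, passing to twins corrects the sheet.\<close>

lemma lift_col:
  assumes x: "lift x p" and y: "y \<in> A" and xy: "x \<sim> y"
  obtains q where "lift y q" "p \<sim> q"
proof -
  obtain N where N: "on x N" "on y N" using xy by (rule colE)
  have xA: "x \<in> A" "p \<in> A" using x liftD by blast+
  obtain K where K: "\<gamma>\<^sub>l N = rosette S S' K"
    using cover_line[OF A_line[OF xA(1) N(1)]] by blast
  have R: "\<gamma>\<^sub>p x \<in> rosette S S' K" "\<gamma>\<^sub>p y \<in> rosette S S' K"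
    using cover_inc[OF xA(1) N(1)] cover_inc[OF y N(2)] K by simp_all
  obtain p' where p': "p' \<in> A" "on p' K" "ovoid p' = \<gamma>\<^sub>p x" using R(1) by (rule rosetteE)
  obtain q' where q': "q' \<in> A" "on q' K" "ovoid q' = \<gamma>\<^sub>p y" using R(2) by (rule rosetteE)
  have q'': "lift y q'" "p' \<sim> q'" using q' y p' colI by (auto simp: lift_def)
  have "lift x p'" using p' xA by (simp add: lift_def)
  then consider "p' = p" | "p' = twin p" using lift_unique x by blast
  then show ?thesis
  proof cases
    case 1
    then show ?thesis using that q'' by blast
  next
    case 2
    then have "p \<sim> twin q'" using q''(2) twin_col_swap[OF xA(2) q'(1)] by simp
    then show ?thesis using that lift_twin[OF q''(1)] by blast
  qed
qed

lemma lift_col_cases: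
  assumes "lift x p" "lift y q" "x \<sim> y"
  shows "p \<sim> q \<or> p \<sim> twin q"
  using lift_col[OF assms(1) _ assms(3)] lift_unique[OF assms(2)] assms(2) liftD(1) by metis

text \<open>Uses that a cover is onto on the lines through a point and on the points of a line: an
  edge between lifts comes from an edge of \<A>.\<close>

lemma lift_col_back:
  assumes y: "lift y r" and p: "p \<in> A" and rp: "r \<sim> p"
  obtains x where "lift x p" "x \<sim> y"
proof -
  obtain K where K: "on r K" "on p K" using rp by (rule colE)
  have yA: "y \<in> A" "r \<in> A" "ovoid r = \<gamma>\<^sub>p y" using y liftD by blast+
  have "rosette S S' K \<in> {R \<in> rosette S S' ` (lines S - lines S'). \<gamma>\<^sub>p y \<in> R}"
    using A_line[OF yA(2) K(1)] rosetteI[OF yA(2) K(1)] yA(3) by simp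
  then obtain N where N: "on y N" "\<gamma>\<^sub>l N = rosette S S' K"
    using cover_lines_through[OF yA(1)] unfolding bij_betw_def by (metis (no_types, lifting) imageE mem_lines_through)
  have "ovoid p \<in> \<gamma>\<^sub>l N" using N rosetteI[OF p K(2)] by simp
  then obtain x where "x \<in> A" "on x N" "ovoid p = \<gamma>\<^sub>p x"
    using cover_points_on[OF A_line[OF yA(1) N(1)]] by (auto simp: bij_betw_def)
  then show ?thesis using that[of x] p N colI by (simp add: lift_def)
qed

text \<open>Two neighbours of \<open>x\<close> are collinear exactly when they lie on one line
  through \<open>x\<close>; the cover is injective on these lines, and likewise for the projection
  at \<open>p\<close>.\<close>

lemma lift_col_iff:
  assumes x: "lift x p" and y: "lift y q" and z: "lift z r"
    and xy: "x \<sim> y" "x \<noteq> y" and xz: "x \<sim> z" "x \<noteq> z" and pq: "p \<sim> q" and pr: "p \<sim> r"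
  shows "y \<sim> z \<longleftrightarrow> q \<sim> r"
proof -
  have A: "x \<in> A" "p \<in> A" "q \<in> A" "r \<in> A" using x y z liftD by blast+
  obtain N\<^sub>1 where N1: "on x N\<^sub>1" "on y N\<^sub>1" using xy(1) by (rule colE)
  obtain N\<^sub>2 where N2: "on x N\<^sub>2" "on z N\<^sub>2" using xz(1) by (rule colE)
  obtain K\<^sub>1 where K1: "on p K\<^sub>1" "on q K\<^sub>1" using pq by (rule colE)
  obtain K\<^sub>2 where K2: "on p K\<^sub>2" "on r K\<^sub>2" using pr by (rule colE)
  have R: "\<gamma>\<^sub>l N\<^sub>1 = rosette S S' K\<^sub>1" "\<gamma>\<^sub>l N\<^sub>2 = rosette S S' K\<^sub>2"
    using lift_line[OF x y xy(2) N1 K1] lift_line[OF x z xz(2) N2 K2] .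
  have ne: "p \<noteq> q" "p \<noteq> r" using lift_neq[OF x y xy] lift_neq[OF x z xz] .
  show ?thesis
  proof
    assume "y \<sim> z"
    then have "on z N\<^sub>1" using no_triangle[OF xy(2) N1, of z] xz col_sym by blast
    then have "N\<^sub>2 = N\<^sub>1" using line_eq[OF N2 N1(1)] xz(2) by blast
    then have "ovoid q \<in> rosette S S' K\<^sub>2" using R rosetteI[OF A(3) K1(2)] by simp
    then obtain q' where q': "q' \<in> A" "on q' K\<^sub>2" "ovoid q' = ovoid q" by (rule rosetteE)
    then consider "q' = q" | "q' = twin q" using twin_unique A by blast
    then show "q \<sim> r"
    proof cases
      case 1
      then show ?thesis using q' K2 colI by blast
    next
      case 2
      then have "p \<sim> twin q" using q' K2 colI by blast
      then show ?thesis using col_twin_False A pq by blast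
    qed
  next
    assume "q \<sim> r"
    then have "on r K\<^sub>1" using no_triangle[OF ne(1) K1, of r] pr col_sym by blast
    then have "K\<^sub>2 = K\<^sub>1" using line_eq[OF K2 K1(1)] ne(2) by blast
    then have "\<gamma>\<^sub>l N\<^sub>1 = \<gamma>\<^sub>l N\<^sub>2" using R by simp
    then have "N\<^sub>1 = N\<^sub>2"
      using inj_onD[OF bij_betw_imp_inj_on[OF cover_lines_through[OF A(1)]]] N1 N2 by simp
    then show "y \<sim> z" using N1 N2 colI by blast
  qed
qed

text \<open>A common neighbour in \<open>A\<close> would contradict \<open>lift_col_iff\<close>, as
  both points share the lift \<open>p\<close>. So all s^2 + 1 common neighbours lie in
  \<open>S'\<close> and form both ovoids.\<close>

lemma cover_fiber:
  assumes x: "x \<in> A" and y: "y \<in> A" and xy: "x \<noteq> y" and eq: "\<gamma>\<^sub>p x = \<gamma>\<^sub>p y"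
  shows "y = twin x"
proof -
  have nc: "\<not> x \<sim> y" using cover_inj[OF x y] xy eq by blast
  obtain p where p: "lift x p" using lift_ex[OF x] .
  have p': "lift y p" using p y eq by (simp add: lift_def)
  have sub: "perp x \<inter> perp y \<subseteq> points S'"
  proof
    fix z assume z: "z \<in> perp x \<inter> perp y"
    show "z \<in> points S'"
    proof (rule ccontr)
      assume "z \<notin> points S'"
      then have zA: "z \<in> A" using z col_point by auto
      have "x \<sim> z" using z col_sym by auto
      then obtain r where r: "lift z r" "p \<sim> r" using lift_col[OF p zA] by blast
      have "z \<noteq> x" "z \<noteq> y" using z nc col_sym by auto
      then have "x \<sim> y \<longleftrightarrow> p \<sim> p"
        using lift_col_iff[OF r(1) p p'] z r(2) col_sym by simp
      then show False using nc col_refl p liftD(2) by auto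
    qed
  qed
  have card: "card (perp x \<inter> perp y) = s\<^sup>2 + 1" using card_common_perp x y nc by simp
  have "perp x \<inter> perp y = ovoid x"
    using sub card card_ovoid[OF x] col_sym by (intro card_subset_eq finite_ovoid) auto
  moreover have "perp x \<inter> perp y = ovoid y"
    using sub card card_ovoid[OF y] col_sym by (intro card_subset_eq finite_ovoid) auto
  ultimately show ?thesis using twin_unique[OF x y] xy by simp
qed

text \<open>A second point over \<open>\<gamma>\<^sub>p x\<close> is produced by walking around a
  triangle of \<E>: the path \<open>p\<close>, \<open>q\<close>, \<open>r'\<close>,
  \<open>twin p\<close> is pulled back to \<open>x\<close>, \<open>w\<close>, \<open>y'\<close>,
  \<open>x'\<close>. Since \<open>x\<close> is not collinear with \<open>y'\<close>, the end
  \<open>x'\<close> differs from \<open>x\<close>, and \<open>cover_fiber\<close> identifies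
  it.\<close>

lemma cover_twin:
  assumes x: "x \<in> A"
  shows "\<gamma>\<^sub>p (twin x) = \<gamma>\<^sub>p x"
proof -
  obtain M where M: "on x M" using ex_line x by blast
  obtain w where w: "w \<in> A" "on w M" "w \<noteq> x" using ex_A_point[OF A_line[OF x M]] by metis
  obtain N where N: "on w N" "N \<noteq> M" using ex_other_line w(1) by blast
  obtain y where y: "y \<in> A" "on y N" "y \<noteq> w" using ex_A_point[OF A_line[OF w(1) N(1)]] by metis
  have col: "w \<sim> x" "w \<sim> y" using M w N y colI by blast+
  obtain q where q: "lift w q" using lift_ex[OF w(1)] .
  obtain p where p: "lift x p" "q \<sim> p" using lift_col[OF q x col(1)] .
  obtain r where r: "lift y r" "q \<sim> r" using lift_col[OF q y(1) col(2)] .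
  obtain K where K: "on q K" "on r K" using r(2) by (rule colE)
  have xN: "\<not> on x N" using line_eq[OF _ N(1) M w(2)] w(3) N(2) by blast
  have "\<not> x \<sim> y" using proj_unique[OF xN N(1) y(2)] col y(3) col_sym by blast
  then have "\<not> on p K"
    using lift_col_iff[OF q p(1) r(1) col(1) w(3) col(2) _ p(2) r(2)] y(3) K colI by blast
  then obtain r' where r': "r' \<in> A" "on r' K" "r' \<sim> twin p" "r' \<noteq> q"
    using twin_proj[OF liftD(2)[OF p(1)] liftD(2)[OF q] _ K(1)] p(2) col_sym by blast
  have "ovoid r' \<in> \<gamma>\<^sub>l N"
    using lift_line[OF q r(1) y(3)[symmetric] N(1) y(2) K] rosetteI[OF r'(1,2)] by simp
  then obtain y' where y': "y' \<in> A" "on y' N" "ovoid r' = \<gamma>\<^sub>p y'"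
    using cover_points_on[OF A_line[OF w(1) N(1)]] by (auto simp: bij_betw_def)
  have "lift y' r'" using y' r' by (simp add: lift_def)
  then obtain x' where x': "lift x' (twin p)" "x' \<sim> y'"
    using lift_col_back[OF _ _ r'(3)] lift_twin[OF p(1)] liftD(2) by blast
  have "ovoid r' \<noteq> ovoid q"
    using not_col_same_ovoid[of r' q] r' K liftD(2)[OF q] colI by blast
  then have "y' \<noteq> w" using y' liftD(3)[OF q] by auto
  then have "\<not> x \<sim> y'" using proj_unique[OF xN N(1) y'(2)] col col_sym by blast
  then have "x' \<noteq> x" using x' by blast
  moreover have eq: "\<gamma>\<^sub>p x = \<gamma>\<^sub>p x'"
    using liftD(3)[OF x'(1)] liftD(3)[OF lift_twin[OF p(1)]] by simp
  ultimately have "x' = twin x" using cover_fiber[OF x liftD(1)[OF x'(1)]] by blast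
  then show ?thesis using eq by simp
qed

lemma lift_of_twin: "lift x p \<Longrightarrow> lift (twin x) p"
  using twin cover_twin by (simp add: lift_def)

lemma lift_eq: "lift x p \<Longrightarrow> lift y p \<Longrightarrow> y = x \<or> y = twin x"
  using cover_fiber[of x y] by (auto simp: lift_def)

text \<open>A triangle of the geometry of subtended ovoids lifts to a path from a point to its twin, under
  the projection and under the cover alike.\<close>

lemma lift_triangle:
  assumes x: "lift x p" and y: "lift y q" and z: "lift z r"
    and xy: "x \<sim> y" "x \<noteq> y" and xz: "x \<sim> z" "x \<noteq> z" and yz: "y \<sim> twin z"
    and pq: "p \<sim> q" and pr: "p \<sim> r"
  shows "q \<sim> twin r"
proof -
  have "\<not> y \<sim> z" using col_twin_False y z yz liftD(1) by blast
  then have "\<not> q \<sim> r" using lift_col_iff[OF x y z xy xz pq pr] by blast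
  then show ?thesis using lift_col_cases[OF y lift_of_twin[OF z] yz] by blast
qed

lemma lift_quadrangle:
  assumes x: "lift x p" and y: "lift y q" and nc: "\<not> x \<sim> y"
    and z: "z \<in> common x y" "lift z r" "p \<sim> r" "r \<sim> q"
    and z': "z' \<in> common x y" "lift z' r'" "p \<sim> r'"
  shows "r' \<sim> q"
proof -
  have xyA: "x \<in> A" "y \<in> A" using x y liftD by blast+
  \<comment> \<open>The middle points through which transport along \<open>x\<close>,
    \<open>v\<close>, \<open>y\<close> starting at \<open>p\<close> ends at a neighbour-consistent
    lift \<open>q\<close>.\<close>
  define Y where "Y = {v \<in> common x y. \<forall>a. lift v a \<longrightarrow> p \<sim> a \<longrightarrow> a \<sim> q}"
  have ne: "v \<noteq> x" "v \<noteq> y" if "v \<in> common x y" for v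
    using that nc col_sym by auto
  have zY: "z \<in> Y"
  proof -
    have "a \<sim> q" if a: "lift z a" "p \<sim> a" for a
    proof -
      have "a \<noteq> twin r"
        using col_twin_False[OF liftD(2)[OF x] liftD(2)[OF z(2)] z(3)] a(2) by blast
      then have "a = r" using lift_unique[OF z(2) a(1)] by blast
      then show ?thesis using z(4) by simp
    qed
    then show ?thesis using z(1) unfolding Y_def by blast
  qed
  have step: "w \<in> Y" if v: "v \<in> Y" and w: "w \<in> common x y" and vw: "v \<sim> twin w" for v w
  proof -
    have vc: "v \<in> common x y" using v by (simp add: Y_def)
    have vA: "v \<in> A" "w \<in> A" using vc w by auto
    obtain b where b: "lift v b" "p \<sim> b" using lift_col[OF x vA(1)] vc col_sym by auto
    have bq: "b \<sim> q" using v b by (auto simp: Y_def)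
    have "a \<sim> q" if a: "lift w a" "p \<sim> a" for a
    proof -
      \<comment> \<open>Two triangles of \<E> are used, on \<open>x\<close>, \<open>v\<close>,
        \<open>w\<close> and on \<open>v\<close>, \<open>y\<close>, \<open>w\<close>. In the second,
        \<open>w\<close> is represented by \<open>twin w\<close> with lift \<open>twin a\<close>,
        because it is \<open>twin w\<close> that is collinear with \<open>v\<close>.\<close>
      have "b \<sim> twin a"
        using lift_triangle[OF x b(1) a(1) _ _ _ _ vw b(2) a(2)] vc w ne[OF vc] ne[OF w] col_sym
        by simp
      moreover have "y \<sim> twin (twin w)" using w vA(2) col_sym by auto
      moreover have "v \<noteq> twin w" using vc w col_twin_False[OF xyA(1) vA(2)] col_sym by auto
      ultimately have "q \<sim> twin (twin a)"
        using lift_triangle[OF b(1) y lift_of_twin[OF lift_twin[OF a(1)]]] vc ne[OF vc] vw bq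
          \<open>b \<sim> twin a\<close> by simp
      then show ?thesis using a liftD(2) col_sym by auto
    qed
    then show ?thesis using w by (simp add: Y_def)
  qed
  have "Y = common x y"
  proof (rule common_connected[OF xyA nc])
    show "Y \<subseteq> common x y" by (auto simp: Y_def)
    show "Y \<noteq> {}" using zY by blast
  qed (rule step)
  then show ?thesis using z' by (auto simp: Y_def)
qed

end

section \<open>Transport from a base point\<close>

locale based_cover = cover_of_ovoids +
  fixes x\<^sub>0 p\<^sub>0 :: 'a
  assumes lift_base: "lift x\<^sub>0 p\<^sub>0"
begin

lemma x0: "x\<^sub>0 \<in> A" and p0: "p\<^sub>0 \<in> A"
  using lift_base liftD by blast+

definition far :: "'a \<Rightarrow> bool" where
  "far y \<longleftrightarrow> y \<in> A \<and> \<not> x\<^sub>0 \<sim> y \<and> \<not> x\<^sub>0 \<sim> twin y"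

text \<open>The three alternatives exclude each other by \<open>col_twin_False\<close>. A relation
  is used since independence of the intermediate point \<open>z\<close> is only proved
  later.\<close>

definition transported :: "'a \<Rightarrow> 'a \<Rightarrow> bool" where
  "transported y q \<longleftrightarrow> lift y q \<and>
     ((x\<^sub>0 \<sim> y \<and> p\<^sub>0 \<sim> q) \<or> (x\<^sub>0 \<sim> twin y \<and> p\<^sub>0 \<sim> twin q) \<or>
      (far y \<and> (\<exists>z r. z \<in> common x\<^sub>0 y \<and> lift z r \<and> p\<^sub>0 \<sim> r \<and> r \<sim> q)))"

lemma transported_lift: "transported y q \<Longrightarrow> lift y q"
  by (simp add: transported_def)

lemma transported_A: "transported y q \<Longrightarrow> y \<in> A" "transported y q \<Longrightarrow> q \<in> A"
  using transported_lift liftD by blast+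

lemma transported_near: "transported y q \<Longrightarrow> x\<^sub>0 \<sim> y \<Longrightarrow> p\<^sub>0 \<sim> q"
  using col_twin_False[OF x0] transported_A(1) by (auto simp: transported_def far_def)

lemma transported_near_twin: "transported y q \<Longrightarrow> x\<^sub>0 \<sim> twin y \<Longrightarrow> p\<^sub>0 \<sim> twin q"
  using col_twin_False[OF x0] transported_A(1) by (auto simp: transported_def far_def)

lemma transported_farE:
  assumes "transported y q" "far y"
  obtains z r where "z \<in> common x\<^sub>0 y" "lift z r" "p\<^sub>0 \<sim> r" "r \<sim> q"
  using assms unfolding transported_def far_def by blast

lemma transported_base: "transported x\<^sub>0 q \<Longrightarrow> q = p\<^sub>0"
  using transported_near[of x\<^sub>0 q] lift_unique[OF lift_base] transported_lift not_col_twin[OF p0]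
    col_refl x0 by blast

lemma transported_ex: assumes y: "y \<in> A" obtains q where "transported y q"
proof -
  consider "x\<^sub>0 \<sim> y" | "x\<^sub>0 \<sim> twin y" | "far y" using y by (auto simp: far_def)
  then show ?thesis
  proof cases
    case 1
    then show ?thesis using lift_col[OF lift_base y] that by (auto simp: transported_def)
  next
    case 2
    then obtain q where q: "lift (twin y) q" "p\<^sub>0 \<sim> q" using lift_col[OF lift_base] twin(1)[OF y] by blast
    then have "lift y (twin q)" using lift_twin lift_of_twin twin_twin[OF y] by metis
    then show ?thesis using that[of "twin q"] 2 q liftD(2)[OF q(1)] by (auto simp: transported_def)
  next
    case 3
    then obtain z where z: "z \<in> common x\<^sub>0 y"
      using common_far_nonempty[OF x0 y] by (auto simp: far_def)
    then have zA: "z \<in> A" and cols: "x\<^sub>0 \<sim> z" "z \<sim> y" using col_sym by auto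
    obtain r where r: "lift z r" "p\<^sub>0 \<sim> r" using lift_col[OF lift_base zA cols(1)] .
    obtain q where "lift y q" "r \<sim> q" using lift_col[OF r(1) y cols(2)] .
    then show ?thesis using that z r 3 by (auto simp: transported_def)
  qed
qed

text \<open>In the far case the middle point \<open>z\<close> is replaced by the point
  \<open>z'\<close> of the line \<open>x\<^sub>0 z\<close> that is collinear with
  \<open>twin y\<close>; the triangle of \<E> on \<open>z\<close>, \<open>y\<close>,
  \<open>z'\<close> compares the two paths.\<close>

lemma transported_twin:
  assumes yq: "transported y q"
  shows "transported (twin y) (twin q)"
proof -
  have A: "y \<in> A" "q \<in> A" and y: "lift y q" using transported_A[OF yq] transported_lift[OF yq] by blast+
  have lift': "lift (twin y) (twin q)" using lift_twin lift_of_twin y by blast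
  consider "x\<^sub>0 \<sim> y" | "x\<^sub>0 \<sim> twin y" | "far y" using A by (auto simp: far_def)
  then show ?thesis
  proof cases
    case 1
    then show ?thesis using lift' transported_near[OF yq] A by (simp add: transported_def)
  next
    case 2
    then show ?thesis using lift' transported_near_twin[OF yq] A by (simp add: transported_def)
  next
    case 3
    then have nc: "\<not> x\<^sub>0 \<sim> y" "\<not> x\<^sub>0 \<sim> twin y" by (auto simp: far_def)
    obtain z r where z: "z \<in> common x\<^sub>0 y" "lift z r" "p\<^sub>0 \<sim> r" "r \<sim> q" using yq 3 by (rule transported_farE)
    have zA: "z \<in> A" and cols: "x\<^sub>0 \<sim> z" "z \<sim> y" "y \<sim> z" using z(1) col_sym by auto
    obtain N where N: "on x\<^sub>0 N" "on z N" using cols(1) by (rule colE)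
    have "\<not> on y N" using nc(1) N colI by blast
    then obtain z' where z': "z' \<in> A" "on z' N" "z' \<sim> twin y" "z' \<noteq> z"
      using twin_proj[OF A(1) zA cols(3) N(2)] by blast
    have cols': "x\<^sub>0 \<sim> z'" "z \<sim> z'" using N z' colI by blast+
    obtain r' where r': "lift z' r'" "p\<^sub>0 \<sim> r'" using lift_col[OF lift_base z'(1) cols'(1)] .
    have ne: "x\<^sub>0 \<noteq> z" "x\<^sub>0 \<noteq> z'" "z \<noteq> y" using cols nc z'(3) by auto
    have "r \<sim> r'"
      using lift_col_iff[OF lift_base z(2) r'(1) cols(1) ne(1) cols'(1) ne(2) z(3) r'(2)] cols'(2) by blast
    then have "r' \<sim> twin q"
      using lift_triangle[OF z(2) r'(1) y cols'(2) z'(4)[symmetric] cols(2) ne(3) z'(3) _ z(4)] by blast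
    moreover have "z' \<in> common x\<^sub>0 (twin y)" using z' cols' col_sym by auto
    moreover have "far (twin y)" using 3 twin by (simp add: far_def)
    ultimately show ?thesis using lift' r' unfolding transported_def by blast
  qed
qed

text \<open>According to the position of \<open>z\<close>, this is local injectivity at
  \<open>x\<^sub>0\<close>, a triangle of \<E>, or the quadrangle \<open>x\<^sub>0\<close>,
  \<open>w\<close>, \<open>z\<close>, \<open>y\<close> with \<open>w\<close> from the transport to
  \<open>z\<close>.\<close>

lemma transported_col_near:
  assumes yq: "transported y q" and zr: "transported z r" and yz: "y \<sim> z" and near: "x\<^sub>0 \<sim> y"
  shows "q \<sim> r"
proof -
  have A: "y \<in> A" "q \<in> A" "z \<in> A" "r \<in> A" using transported_A yq zr by blast+
  have l: "lift y q" "lift z r" using transported_lift yq zr by blast+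
  have pq: "p\<^sub>0 \<sim> q" using transported_near yq near by blast
  consider "x\<^sub>0 \<sim> z" | "x\<^sub>0 \<sim> twin z" | "far z" using A by (auto simp: far_def)
  then show ?thesis
  proof cases
    case 1
    have pr: "p\<^sub>0 \<sim> r" using transported_near zr 1 by blast
    show ?thesis
    proof (cases "y = x\<^sub>0 \<or> z = x\<^sub>0")
      case True
      then show ?thesis using transported_base yq zr pq pr col_sym by metis
    next
      case False
      then show ?thesis using lift_col_iff[OF lift_base l near _ 1 _ pq pr] yz by blast
    qed
  next
    case 2
    have pr: "p\<^sub>0 \<sim> twin r" using transported_near_twin zr 2 by blast
    have ne: "x\<^sub>0 \<noteq> y" using col_twin_False[OF x0 A(3)] 2 yz by blast
    have ne': "x\<^sub>0 \<noteq> twin z" using col_twin_False[OF A(1,3) yz] near col_sym by blast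
    have "lift (twin z) (twin r)" using lift_twin lift_of_twin l by blast
    then have "q \<sim> twin (twin r)"
      using lift_triangle[OF lift_base l(1) _ near ne 2 ne' _ pq pr] yz A by simp
    then show ?thesis using A by simp
  next
    case 3
    then have nc: "\<not> x\<^sub>0 \<sim> z" by (simp add: far_def)
    obtain w a where w: "w \<in> common x\<^sub>0 z" "lift w a" "p\<^sub>0 \<sim> a" "a \<sim> r" using zr 3 by (rule transported_farE)
    have "y \<in> common x\<^sub>0 z" using near yz A col_sym by auto
    then show ?thesis using lift_quadrangle[OF lift_base l(2) nc w _ l(1) pq] by blast
  qed
qed

lemma transported_col_not_far:
  assumes yq: "transported y q" and zr: "transported z r" and yz: "y \<sim> z" and "\<not> far y"
  shows "q \<sim> r"
proof -
  have A: "y \<in> A" "q \<in> A" "z \<in> A" "r \<in> A" using transported_A yq zr by blast+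
  then consider "x\<^sub>0 \<sim> y" | "x\<^sub>0 \<sim> twin y" using assms(4) by (auto simp: far_def)
  then show ?thesis
  proof cases
    case 1
    then show ?thesis using transported_col_near yq zr yz by blast
  next
    case 2
    then have "twin q \<sim> twin r"
      using transported_col_near transported_twin yq zr twin_col[OF A(1,3) yz] by blast
    then show ?thesis using twin_col[of "twin q" "twin r"] twin(1) A by simp
  qed
qed

text \<open>The projection of \<open>x\<^sub>0\<close> onto \<open>N\<close> lies in
  \<open>A\<close>, so it is a near point with which both \<open>y\<close> and \<open>z\<close> can
  be compared.\<close>

lemma transported_col_good_line:
  assumes yq: "transported y q" and zr: "transported z r" and yz: "y \<noteq> z" and N: "on y N" "on z N"
    and good: "base N \<notin> ovoid x\<^sub>0"
  shows "q \<sim> r"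
proof -
  have A: "y \<in> A" "q \<in> A" "z \<in> A" "r \<in> A" using transported_A yq zr by blast+
  have l: "lift y q" "lift z r" using transported_lift yq zr by blast+
  have col: "y \<sim> z" "z \<sim> y" using N colI by blast+
  show ?thesis
  proof (cases "far y \<and> far z")
    case True
    obtain w where w: "on w N" "x\<^sub>0 \<sim> w" using proj_ex[of x\<^sub>0 N] x0 on_line[OF N(1)] by blast
    have wA: "w \<in> A"
    proof (rule ccontr)
      assume "w \<notin> A"
      then have "w \<in> points S'" using w on_point by blast
      then have "base N \<in> ovoid x\<^sub>0" using base_unique[OF A(1) N(1), of w] w by auto
      then show False using good by simp
    qed
    have ne: "w \<noteq> y" "w \<noteq> z" using w True by (auto simp: far_def)
    have wc: "w \<sim> y" "w \<sim> z" using w N colI by blast+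
    obtain a where a: "transported w a" using transported_ex[OF wA] .
    have "a \<sim> q" "a \<sim> r" using transported_col_near[OF a _ _ w(2)] yq zr wc by blast+
    then show ?thesis
      using lift_col_iff[OF transported_lift[OF a] l wc(1) ne(1) wc(2) ne(2)] col by blast
  next
    case False
    then show ?thesis
      using transported_col_not_far[OF yq zr col(1)] transported_col_not_far[OF zr yq col(2)] col_sym by blast
  qed
qed

text \<open>If \<open>x\<^sub>0\<close> is collinear with the base point of the line \<open>y z\<close>, that line is replaced by a path
  from \<open>y\<close> over a point \<open>m\<close> to \<open>twin z\<close>; at most \<open>2 s\<close> of the \<open>s\<^sup>2\<close> choices of \<open>m\<close> are excluded.\<close>

lemma transported_col:
  assumes yq: "transported y q" and zr: "transported z r" and yz: "y \<sim> z"
  shows "q \<sim> r"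
proof -
  have A: "y \<in> A" "q \<in> A" "z \<in> A" "r \<in> A" using transported_A yq zr by blast+
  have l: "lift y q" "lift z r" using transported_lift yq zr by blast+
  show ?thesis
  proof (cases "far y \<and> far z")
    case False
    then show ?thesis
      using transported_col_not_far[OF yq zr yz] transported_col_not_far[OF zr yq] yz col_sym by blast
  next
    case True
    then have far: "far y" "far z" by blast+
    show ?thesis
    proof (cases "y = z")
      case True
      have nc: "\<not> x\<^sub>0 \<sim> y" using far by (simp add: far_def)
      obtain w a where w: "w \<in> common x\<^sub>0 y" "lift w a" "p\<^sub>0 \<sim> a" "a \<sim> q" using yq far(1) by (rule transported_farE)
      obtain w' a' where w': "w' \<in> common x\<^sub>0 z" "lift w' a'" "p\<^sub>0 \<sim> a'" "a' \<sim> r" using zr far(2) by (rule transported_farE)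
      \<comment> \<open>This yields uniqueness of the transported lift: the paths through
        \<open>w\<close> and \<open>w'\<close> end on the same sheet.\<close>
      have "a' \<sim> q" using lift_quadrangle[OF lift_base l(1) nc w _ w'(2,3)] w'(1) True by simp
      then have "r \<noteq> twin q" using col_twin_False[of a' q] w' liftD(2) A by blast
      then have "r = q" using lift_unique[OF l(1)] l(2) True by blast
      then show ?thesis using col_refl A by auto
    next
      case False
      obtain N where N: "on y N" "on z N" using yz by (rule colE)
      show ?thesis
      proof (cases "base N \<in> ovoid x\<^sub>0")
        case False
        then show ?thesis using transported_col_good_line[OF yq zr \<open>y \<noteq> z\<close> N] by blast
      next
        case True
        have z': "twin z \<in> A" "ovoid (twin z) = ovoid z" "far (twin z)"
          using twin[OF A(3)] far A(3) by (auto simp: far_def)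
        have nc: "\<not> y \<sim> twin z" using col_twin_False A yz by blast
        have u: "base N \<in> ovoid y" "base N \<in> ovoid (twin z)"
          using base[OF A(1) N(1)] N colI z'(2) by auto
        \<comment> \<open>The choices of \<open>m\<close> to be avoided: those whose line to
          \<open>y\<close> or to \<open>twin z\<close> has its base in
          \<open>ovoid x\<^sub>0\<close>.\<close>
        define B\<^sub>1 where "B\<^sub>1 = {m \<in> common y (twin z). \<exists>M. on y M \<and> on m M \<and> base M \<in> ovoid x\<^sub>0}"
        define B\<^sub>2 where "B\<^sub>2 = {m \<in> common (twin z) y. \<exists>M. on (twin z) M \<and> on m M \<and> base M \<in> ovoid x\<^sub>0}"
        have "card B\<^sub>1 \<le> s"
          unfolding B\<^sub>1_def using far z' nc u True
          by (intro card_common_base[OF x0 A(1) z'(1), of "base N"]) (simp_all add: far_def)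
        moreover have "card B\<^sub>2 \<le> s"
          unfolding B\<^sub>2_def using far z' nc u True col_sym[of "twin z" y]
          by (intro card_common_base[OF x0 z'(1) A(1), of "base N"]) (auto simp: far_def)
        ultimately have "card (B\<^sub>1 \<union> B\<^sub>2) \<le> 2 * s" using card_Un_le[of B\<^sub>1 B\<^sub>2] by linarith
        also have "2 * s < s\<^sup>2"
          using far_imp_s_gt_2[OF x0 A(1)] far by (simp add: far_def power2_eq_square)
        \<comment> \<open>Of the s^2 + 1 common neighbours only \<open>base N\<close> lies in
          \<open>S'\<close>, since \<open>twin z\<close> subtends the ovoid of \<open>z\<close> and
          \<open>y\<close>, \<open>z\<close> are collinear.\<close>
        also have "s\<^sup>2 = card (common y (twin z))"
          using card_common[OF A(1) z'(1) nc] ovoid_Int_col[OF A(1,3) \<open>y \<noteq> z\<close> N] z'(2) by simp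
        finally have less: "card (B\<^sub>1 \<union> B\<^sub>2) < card (common y (twin z))" .
        have "finite (B\<^sub>1 \<union> B\<^sub>2)" using finite_common by (simp add: B\<^sub>1_def B\<^sub>2_def del: mem_common)
        then have "\<not> common y (twin z) \<subseteq> B\<^sub>1 \<union> B\<^sub>2" using card_mono less leD by blast
        then obtain m where m: "m \<in> common y (twin z)" "m \<notin> B\<^sub>1" "m \<notin> B\<^sub>2" by blast
        have mA: "m \<in> A" and mc: "m \<sim> y" "m \<sim> twin z" using m(1) by auto
        have ne: "m \<noteq> y" "m \<noteq> twin z" using mc nc col_sym by auto
        obtain a where a: "transported m a" using transported_ex[OF mA] .
        have z'r: "transported (twin z) (twin r)" using transported_twin[OF zr] .
        obtain M where M: "on m M" "on y M" using mc(1) by (rule colE)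
        have "base M \<notin> ovoid x\<^sub>0" using m(1,2) M by (auto simp: B\<^sub>1_def)
        then have aq: "a \<sim> q" using transported_col_good_line[OF a yq ne(1) M] by blast
        obtain K where K: "on m K" "on (twin z) K" using mc(2) by (rule colE)
        have "base K \<notin> ovoid x\<^sub>0" using m(1,3) K common_sym by (auto simp: B\<^sub>2_def)
        then have ar: "a \<sim> twin r" using transported_col_good_line[OF a z'r ne(2) K] by blast
        have "q \<sim> twin (twin r)"
          using lift_triangle[OF transported_lift[OF a] l(1) transported_lift[OF z'r] mc(1) ne(1) mc(2) ne(2) _ aq ar]
            yz A by simp
        then show ?thesis using A by simp
      qed
    qed
  qed
qed

definition cover_lift :: "'a \<Rightarrow> 'a" where
  "cover_lift y = (SOME q. transported y q)"

lemma transported_cover_lift: "y \<in> A \<Longrightarrow> transported y (cover_lift y)"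
  unfolding cover_lift_def by (rule transported_ex) (auto intro: someI)

lemma cover_lift_A: "y \<in> A \<Longrightarrow> cover_lift y \<in> A"
  and ovoid_cover_lift: "y \<in> A \<Longrightarrow> ovoid (cover_lift y) = \<gamma>\<^sub>p y"
  using transported_cover_lift transported_lift liftD by blast+

lemma cover_lift_col: "y \<in> A \<Longrightarrow> z \<in> A \<Longrightarrow> y \<sim> z \<Longrightarrow> cover_lift y \<sim> cover_lift z"
  using transported_cover_lift transported_col by blast

text \<open>Only twins could share a value, but their transported lifts are twins of each other, up
  to the uniqueness in \<open>transported_col\<close>.\<close>

lemma inj_on_cover_lift: "inj_on cover_lift A"
proof (rule inj_onI, rule ccontr)
  fix y z assume yz: "y \<in> A" "z \<in> A" "cover_lift y = cover_lift z" "y \<noteq> z"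
  then have "z = twin y"
    using lift_eq[of y "cover_lift y" z] transported_cover_lift transported_lift by metis
  then have "transported z (twin (cover_lift y))"
    using transported_twin[OF transported_cover_lift[OF yz(1)]] by simp
  then have "cover_lift z \<sim> twin (cover_lift y)"
    using transported_col transported_cover_lift yz(2) col_refl by blast
  then show False using not_col_twin cover_lift_A yz by simp
qed

end

context doubly_subtended_pair
begin

theorem projection_higher_decomposition:
  "higher_decomposition_property S S' (subtended_by S S') (rosette S S')"
  unfolding higher_decomposition_property_def
proof (intro allI impI)
  fix \<gamma>\<^sub>p \<gamma>\<^sub>l assume "cover (geom_A S S') (geom_E S S') \<gamma>\<^sub>p \<gamma>\<^sub>l"
  then interpret cover_of_ovoids S s S' \<gamma>\<^sub>p \<gamma>\<^sub>l by unfold_locales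
  obtain x\<^sub>0 where "x\<^sub>0 \<in> A" by (rule ex_A)
  then obtain p\<^sub>0 where "lift x\<^sub>0 p\<^sub>0" by (rule lift_ex)
  then interpret based_cover S s S' \<gamma>\<^sub>p \<gamma>\<^sub>l x\<^sub>0 p\<^sub>0 by unfold_locales
  obtain f g where fg: "automorphism S f g" "stabilizes f g S'" "\<And>x. x \<in> A \<Longrightarrow> f x = cover_lift x"
    "\<And>N. N \<in> lines S \<Longrightarrow> points_on S (g N) = f ` points_on S N"
    using extend_to_automorphism[OF cover_lift_A inj_on_cover_lift cover_lift_col] by blast
  have \<gamma>: "\<gamma>\<^sub>p x = ovoid (f x)" if "x \<in> A" for x using ovoid_cover_lift fg(3) that by simp
  have "\<gamma>\<^sub>l N = rosette S S' (g N)" if N: "N \<in> lines S - lines S'" for N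
  proof -
    \<comment> \<open>A rosette is the set of its ovoids, so the line part of the factorization
      follows from the point part once \<open>f\<close> is known to carry the points of
      \<open>N\<close> in \<open>A\<close> to those of \<open>g N\<close>.\<close>
    have "f x \<in> A \<longleftrightarrow> x \<in> A" if "x \<in> points S" for x
      using fg(1,2) that permutes_in_image[of f "points S" x] inj_image_mem_iff[OF permutes_inj, of f "points S" x "points S'"]
      by (auto simp: automorphism_def stabilizes_def)
    then have "{y \<in> A. on y (g N)} = f ` {x \<in> A. on x N}"
      using fg(4)[of N] N on_point mem_points_on by (auto simp: set_eq_iff image_iff) blast+
    then have "rosette S S' (g N) = ovoid ` f ` {x \<in> A. on x N}" by (simp add: rosette_eq)
    also have "\<dots> = \<gamma>\<^sub>p ` {x \<in> A. on x N}" unfolding image_image using \<gamma> by (intro image_cong) auto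
    also have "\<dots> = \<gamma>\<^sub>l N" using cover_points_on[OF N] by (rule bij_betw_imp_surj_on)
    finally show ?thesis by simp
  qed
  then show "\<exists>\<alpha>\<^sub>p \<alpha>\<^sub>l. automorphism S \<alpha>\<^sub>p \<alpha>\<^sub>l \<and> stabilizes \<alpha>\<^sub>p \<alpha>\<^sub>l S' \<and>
      (\<forall>x\<in>points (geom_A S S'). \<gamma>\<^sub>p x = subtended_by S S' (\<alpha>\<^sub>p x)) \<and>
      (\<forall>N\<in>lines (geom_A S S'). \<gamma>\<^sub>l N = rosette S S' (\<alpha>\<^sub>l N))"
    using fg(1,2) \<gamma> by (auto simp: geom_A_def intro!: exI[of _ f] exI[of _ g])
qed

end

theorem theorem6p5:
  fixes S S' :: "('p, 'l) geometry" and s :: nat and L :: 'l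
  assumes "thick_GQ S s (s\<^sup>2)"
    and "L \<in> lines S"
    and "\<forall>x\<in>points_on S L. translation_point S s x"
    and "subquadrangle S' S s s"
    and "L \<in> lines S'"
    and "\<forall>O'\<in>subtended_ovoids S S'. doubly_subtended S S' O'"
  shows "higher_decomposition_property S S' (subtended_by S S') (rosette S S')"
proof -
  interpret doubly_subtended_pair S s S'
    using assms by unfold_locales (simp_all add: thick_GQ_def)
  show ?thesis by (rule projection_higher_decomposition)
qed

end
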